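(* Let $0<\alpha<1$, let $v\in S(\mathbb{R})$ and put $u:=r_+v$. Then there is a function $m:[0,\infty)\to\mathbb{R}$, which is $O(|w|^{-1-2\alpha})$ for small $|w|$ and $O(e^{-|w|})$ as $|w|\to\infty$, such that for every $x>0$ $$(\mathcal{A}u)(x)=u(x)+\lim_{\epsilon\searrow 0}\int_0^\infty (u(x)-u(y))\,\chi_\epsilon(|x-y|)\,m(|x-y|)\,dy,$$ and moreover $$(\mathcal{A}u,u)=\int_0^\infty|u(x)|^2\,dx+\tfrac12\int_0^\infty\!\!\int_0^\infty|u(x)-u(y)|^2\,m(|x-y|)\,dy\,dx .$$
   Context: $S(\mathbb{R})$ is the Schwartz space and $S'(\mathbb{R})$ the tempered distributions. The Fourier transform is $(\mathcal{F}u)(\xi)=(2\pi)^{-1/2}\int_{\mathbb{R}}e^{i\xi x}u(x)\,dx$, extended to $S'(\mathbb{R})$. $A$ is the pseudodifferential operator $A=\mathcal{F}^{-1}(1+\xi^2)^{\alpha}\mathcal{F}$. $r_+$ denotes restriction from $\mathbb{R}$ to $\mathbb{R}_+=(0,\infty)$, $e_+$ extension by zero from $\mathbb{R}_+$ to $\mathbb{R}$, and $\chi_{\mathbb{R}_-}$ the characteristic function of $(-\infty,0)$. The operator $\mathcal{A}$ is defined by $\mathcal{A}u:=r_+Ae_+u+u\cdot r_+A(\chi_{\mathbb{R}_-})$. For $\epsilon>0$, $\chi_\epsilon$ is the characteristic function of $(\epsilon,\infty)$. $(f,g)=\int_0^\infty f(x)\overline{g(x)}\,dx$. *)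

theory Defs
  imports "HOL-Analysis.Analysis" "HOL-Library.Landau_Symbols"
begin

definition vderiv_iter :: "nat \<Rightarrow> (real \<Rightarrow> complex) \<Rightarrow> real \<Rightarrow> complex" where
  "vderiv_iter n f = ((\<lambda>g x. vector_derivative g (at x)) ^^ n) f"

definition smooth_fun :: "(real \<Rightarrow> complex) \<Rightarrow> bool" where
  "smooth_fun f \<longleftrightarrow> (\<forall>n x. vderiv_iter n f differentiable (at x))"

definition schwartz :: "(real \<Rightarrow> complex) \<Rightarrow> bool" where
  "schwartz f \<longleftrightarrow> smooth_fun f \<and>
     (\<forall>k n. \<exists>C. \<forall>x. \<bar>x\<bar> ^ k * norm (vderiv_iter n f x) \<le> C)"

text \<open>Test functions C_c^infinity((0,infinity)), identified with their extension by zero to R.\<close>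
definition test_fun_Rplus :: "(real \<Rightarrow> complex) \<Rightarrow> bool" where
  "test_fun_Rplus \<phi> \<longleftrightarrow> smooth_fun \<phi> \<and>
     (\<exists>a b. 0 < a \<and> (\<forall>x. x \<notin> {a..b} \<longrightarrow> \<phi> x = 0))"

definition fourier :: "(real \<Rightarrow> complex) \<Rightarrow> real \<Rightarrow> complex" where
  "fourier u \<xi> = complex_of_real (1 / sqrt (2 * pi)) *
     (LINT x|lborel. exp (\<i> * complex_of_real (\<xi> * x)) * u x)"

definition fourier_inv :: "(real \<Rightarrow> complex) \<Rightarrow> real \<Rightarrow> complex" where
  "fourier_inv w x = complex_of_real (1 / sqrt (2 * pi)) *
     (LINT \<xi>|lborel. exp (- \<i> * complex_of_real (\<xi> * x)) * w \<xi>)"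

definition Aop :: "real \<Rightarrow> (real \<Rightarrow> complex) \<Rightarrow> real \<Rightarrow> complex" where
  "Aop \<alpha> \<phi> = fourier_inv (\<lambda>\<xi>. complex_of_real ((1 + \<xi>\<^sup>2) powr \<alpha>) * fourier \<phi> \<xi>)"

text \<open>Action of the distribution \<A>u = r_+ A e_+ u + u * r_+ A(chi_{R_-}) (u = r_+ v) on a
  test function phi in C_c^infinity(R_+), via the (bilinear) duality extension of A to S'
  (A is its own transpose since its symbol is even):
  <r_+ A e_+ u, phi> = <e_+ u, A phi>,  <u * r_+ A chi_-, phi> = <chi_-, A(e_+(u phi))>.\<close>
definition Acal_pairing :: "real \<Rightarrow> (real \<Rightarrow> complex) \<Rightarrow> (real \<Rightarrow> complex) \<Rightarrow> complex" where
  "Acal_pairing \<alpha> v \<phi> =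
     (LINT x:{0<..}|lborel. v x * Aop \<alpha> \<phi> x) +
     (LINT x:{..<0}|lborel. Aop \<alpha> (\<lambda>y. v y * \<phi> y) x)"

definition Acal :: "real \<Rightarrow> (real \<Rightarrow> complex) \<Rightarrow> real \<Rightarrow> complex" where
  "Acal \<alpha> v = (SOME h. continuous_on {0<..} h \<and>
     (\<forall>\<phi>. test_fun_Rplus \<phi> \<longrightarrow> Acal_pairing \<alpha> v \<phi> = (LINT x:{0<..}|lborel. h x * \<phi> x)))"

end

theory Submission
  imports Defs "HOL-Probability.Probability"
begin

text \<open>
  Subordination to the heat semigroup gives a kernel \<open>m > 0\<close> with
  \<open>(1 + \<xi>\<^sup>2)\<^sup>\<alpha> = 1 + 2 \<integral>\<^bsub>w>0\<^esub> (1 - cos (\<xi> w)) m(w) dw\<close>. By Fourier inversion,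
  \<open>A f(x) = f(x) + \<integral>\<^bsub>w>0\<^esub> (2 f(x) - f(x + w) - f(x - w)) m(w) dw\<close> for test functions \<open>f\<close>.
  Moving the translations from the test function to \<open>v\<close> for each fixed \<open>w\<close>, the two halves of the pairing
  add up: the term \<open>u A(\<chi>)\<close> cancels exactly the part of \<open>A e\<^sub>+ u\<close> that comes from jumps leaving
  the half-line. What remains is a continuous density, and smooth bump functions show that
  it is the only one. In the quadratic form, shifting the backward differences by \<open>w\<close> turns
  them and the forward differences into \<open>|v(x) - v(x + w)|\<^sup>2\<close>, again for each fixed \<open>w\<close>.
\<close>

section \<open>Smooth functions and test functions\<close>

text \<open>The kernel has a singularity of order w^(-1-2\<alpha>) at 0. It is not integrable there,
  and for \<alpha> \<ge> 1/2 even a first-order difference does not compensate it. Hence differences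
  are split into their single terms, and these shifted, only while w is frozen; the recombined
  integrands are absolutely integrable on the product space, so that Fubini applies before and
  after. The second obstacle is the boundary: for w \<ge> y the point y - w has left the half-line,
  the first-order terms no longer cancel, and only order w remains. Test functions avoid this by
  vanishing near 0; the quadratic form regains the missing factor from the length w of the strip 0 <
  y \<le> w. Finally, \<open>Acal\<close> is a choice among continuous densities, so existence and
  uniqueness of the density precede every statement about its values.\<close>

lemma vderiv_iter_0 [simp]: "vderiv_iter 0 f = f"
  by (simp add: vderiv_iter_def)

lemma vderiv_iter_Suc: "vderiv_iter (Suc n) f = (\<lambda>x. vector_derivative (vderiv_iter n f) (at x))"
  by (simp add: vderiv_iter_def)

lemma smooth_fun_has_vector_derivative:
  "smooth_fun f \<Longrightarrow> (vderiv_iter n f has_vector_derivative vderiv_iter (Suc n) f x) (at x)"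
  by (simp add: smooth_fun_def vderiv_iter_Suc vector_derivative_works)

lemma continuous_on_vderiv_iter: "smooth_fun f \<Longrightarrow> continuous_on S (vderiv_iter n f)"
  by (meson smooth_fun_has_vector_derivative continuous_at_imp_continuous_on
      has_vector_derivative_continuous)

text \<open>A class of functions that is closed under differentiation consists of smooth functions.
  Choosing such a class \<open>P\<close> replaces a closed formula for the n-th derivative.\<close>

lemma smooth_fun_coinduct:
  assumes "P f"
    and step: "\<And>g. P g \<Longrightarrow> \<exists>g'. P g' \<and> (\<forall>x. (g has_vector_derivative g' x) (at x))"
  shows "smooth_fun f"
proof -
  have P: "P (vderiv_iter n f)" for n
  proof (induction n)
    case (Suc n)
    then obtain g' where g': "P g'" "\<And>x. (vderiv_iter n f has_vector_derivative g' x) (at x)"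
      using step by blast
    then have "vderiv_iter (Suc n) f = g'"
      by (auto simp: vderiv_iter_Suc vector_derivative_at)
    with g' show ?case by simp
  qed (use assms in simp)
  show ?thesis
    unfolding smooth_fun_def using step[OF P] differentiableI_vector by blast
qed

text \<open>The class for products: all finite sums of terms as in the Leibniz formula. Binomial
  coefficients need no bookkeeping, since summands may repeat.\<close>

inductive leibniz_sum :: "(real \<Rightarrow> complex) \<Rightarrow> (real \<Rightarrow> complex) \<Rightarrow> (real \<Rightarrow> complex) \<Rightarrow> bool"
  for f g where
  summand: "leibniz_sum f g (\<lambda>x. vderiv_iter i f x * vderiv_iter j g x)"
| add: "leibniz_sum f g u \<Longrightarrow> leibniz_sum f g w \<Longrightarrow> leibniz_sum f g (\<lambda>x. u x + w x)"

lemma smooth_fun_mult: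
  assumes "smooth_fun f" "smooth_fun g"
  shows "smooth_fun (\<lambda>x. f x * g x)"
proof (rule smooth_fun_coinduct[where P = "leibniz_sum f g"])
  show "leibniz_sum f g (\<lambda>x. f x * g x)"
    using leibniz_sum.summand[of f g 0 0] by simp
next
  fix u assume "leibniz_sum f g u"
  then show "\<exists>u'. leibniz_sum f g u' \<and> (\<forall>x. (u has_vector_derivative u' x) (at x))"
  proof induction
    case (summand i j)
    let ?u = "\<lambda>x. vderiv_iter i f x * vderiv_iter (Suc j) g x + vderiv_iter (Suc i) f x * vderiv_iter j g x"
    have "leibniz_sum f g ?u"
      by (intro leibniz_sum.intros)
    moreover have "((\<lambda>x. vderiv_iter i f x * vderiv_iter j g x) has_vector_derivative ?u x) (at x)" for x
      by (intro has_vector_derivative_mult smooth_fun_has_vector_derivative assms)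
    ultimately show ?case by (intro exI[of _ ?u]) auto
  next
    case (add u w)
    then obtain u' w' where *: "leibniz_sum f g u'" "\<forall>x. (u has_vector_derivative u' x) (at x)"
      "leibniz_sum f g w'" "\<forall>x. (w has_vector_derivative w' x) (at x)" by blast
    then show ?case
      by (intro exI[of _ "\<lambda>x. u' x + w' x"])
        (auto intro!: leibniz_sum.intros has_vector_derivative_add)
  qed
qed

section \<open>Flat exponentials and bump functions\<close>

definition flat_exp :: "real poly \<Rightarrow> real \<Rightarrow> real" where
  "flat_exp p x = (if x > 0 then poly p (1 / x) * exp (- (1 / x)) else 0)"

text \<open>The free exponent \<open>k\<close> serves the induction: splitting off the constant
  coefficient of the polynomial turns \<open>k\<close> into \<open>Suc k\<close>.\<close>

lemma tendsto_poly_times_exp_minus: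
  fixes p :: "real poly"
  shows "((\<lambda>x. x ^ k * poly p x * exp (- x)) \<longlongrightarrow> 0) at_top"
proof (induction p arbitrary: k)
  case (pCons a p)
  have "((\<lambda>x::real. a * (x ^ k / exp x) + x ^ Suc k * poly p x * exp (- x)) \<longlongrightarrow> a * 0 + 0) at_top"
    by (intro tendsto_intros pCons tendsto_power_div_exp_0)
  then show ?case
    by (simp add: algebra_simps exp_minus divide_inverse)
qed simp

text \<open>For x > 0, differentiating p(1/x) exp(-1/x) yields (p - p')(1/x) / x^2 times the same
  exponential, which explains the factor X^2. The family with an arbitrary polynomial is thus closed
  under differentiation. At 0 the difference quotient becomes X p(X) exp(-X) under X = 1/h and tends
  to 0.\<close>

lemma flat_exp_has_real_derivative:
  "(flat_exp p has_real_derivative flat_exp ([:0, 0, 1:] * (p - pderiv p)) x) (at x)"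
proof -
  consider "x > 0" | "x < 0" | "x = 0" by linarith
  then show ?thesis
  proof cases
    case 1
    have "((\<lambda>x. poly p (1 / x) * exp (- (1 / x))) has_real_derivative
        flat_exp ([:0, 0, 1:] * (p - pderiv p)) x) (at x)"
      using 1 by (auto intro!: derivative_eq_intros poly_DERIV[THEN DERIV_chain2]
          simp: flat_exp_def field_simps power2_eq_square)
    then show ?thesis
      by (rule has_field_derivative_transform_within_open[of _ _ _ "{0<..}"])
        (use 1 in \<open>auto simp: flat_exp_def\<close>)
  next
    case 2
    have "((\<lambda>x. 0) has_real_derivative flat_exp ([:0, 0, 1:] * (p - pderiv p)) x) (at x)"
      using 2 by (simp add: flat_exp_def)
    then show ?thesis
      by (rule has_field_derivative_transform_within_open[of _ _ _ "{..<0}"])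
        (use 2 in \<open>auto simp: flat_exp_def\<close>)
  next
    case 3
    have right: "((\<lambda>h. flat_exp p h / h) \<longlongrightarrow> 0) (at_right 0)"
      unfolding filterlim_at_right_to_top
    proof (rule Lim_transform_eventually[OF tendsto_poly_times_exp_minus[of 1 p]])
      show "\<forall>\<^sub>F x in at_top. x ^ 1 * poly p x * exp (- x) = flat_exp p (inverse x) / inverse x"
        using eventually_gt_at_top[of 0] by eventually_elim (auto simp: flat_exp_def field_simps)
    qed
    have left: "((\<lambda>h. flat_exp p h / h) \<longlongrightarrow> 0) (at_left 0)"
      by (rule tendsto_eventually)
        (auto simp: flat_exp_def eventually_at_filter)
    have "((\<lambda>h. flat_exp p h / h) \<longlongrightarrow> 0) (at 0)"
      using left right by (simp add: filterlim_at_split)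
    then have "(flat_exp p has_real_derivative 0) (at 0)"
      by (simp add: has_field_derivative_iff flat_exp_def)
    then show ?thesis using 3 by (simp add: flat_exp_def)
  qed
qed

text \<open>The chain rule factor \<open>s\<close> is absorbed into the polynomial, so the class
  stays closed. The bump below uses \<open>s = 1\<close> and \<open>s = -1\<close>.\<close>

lemma smooth_fun_flat_exp_affine:
  "smooth_fun (\<lambda>x. complex_of_real (flat_exp p (s * x + d)))"
proof (rule smooth_fun_coinduct[where P = "\<lambda>f. \<exists>p. f = (\<lambda>x. complex_of_real (flat_exp p (s * x + d)))"])
  fix g assume "\<exists>p. g = (\<lambda>x. complex_of_real (flat_exp p (s * x + d)))"
  then obtain p where g: "g = (\<lambda>x. complex_of_real (flat_exp p (s * x + d)))" by blast
  define r where "r = [:0, 0, 1:] * (p - pderiv p)"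
  define q where "q = smult s r"
  have q: "flat_exp q y = flat_exp r y * s" for y
    by (simp add: q_def flat_exp_def)
  have "((\<lambda>x. flat_exp p (s * x + d)) has_real_derivative flat_exp q (s * x + d)) (at x)" for x
  proof -
    have "((\<lambda>x. s * x + d) has_real_derivative s) (at x)"
      by (auto intro!: derivative_eq_intros)
    from DERIV_chain[OF flat_exp_has_real_derivative this, of p] show ?thesis
      by (simp only: q r_def o_def)
  qed
  then have "(g has_vector_derivative complex_of_real (flat_exp q (s * x + d))) (at x)" for x
    unfolding g by (intro has_vector_derivative_of_real)
      (simp add: has_real_derivative_iff_has_vector_derivative)
  then show "\<exists>g'. (\<exists>p. g' = (\<lambda>x. complex_of_real (flat_exp p (s * x + d)))) \<and>
      (\<forall>x. (g has_vector_derivative g' x) (at x))" by (intro exI[of _ "\<lambda>x. complex_of_real (flat_exp q (s * x + d))"]) auto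
qed (rule exI, rule refl)

text \<open>The witness is exp(-1/(x - a)) exp(-1/(b - x)), each factor being extended by
  zero.\<close>

lemma test_fun_bump_exists:
  assumes "0 < a" "a < b"
  obtains \<phi> :: "real \<Rightarrow> real" where
    "test_fun_Rplus (\<lambda>x. complex_of_real (\<phi> x))" "continuous_on UNIV \<phi>"
    "\<And>x. 0 \<le> \<phi> x" "\<And>x. a < x \<Longrightarrow> x < b \<Longrightarrow> 0 < \<phi> x" "\<And>x. x \<notin> {a..b} \<Longrightarrow> \<phi> x = 0"
proof
  let ?\<phi> = "\<lambda>x. flat_exp 1 (1 * x + (- a)) * flat_exp 1 (- 1 * x + b)"
  show zero: "?\<phi> x = 0" if "x \<notin> {a..b}" for x
    using that by (auto simp: flat_exp_def)
  have "smooth_fun (\<lambda>x. complex_of_real (?\<phi> x))"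
    unfolding of_real_mult by (intro smooth_fun_mult smooth_fun_flat_exp_affine)
  then show "test_fun_Rplus (\<lambda>x. complex_of_real (?\<phi> x))"
    unfolding test_fun_Rplus_def of_real_eq_0_iff using zero assms(1) by blast
  have cont: "continuous_on UNIV (flat_exp 1)"
    by (meson DERIV_isCont continuous_at_imp_continuous_on flat_exp_has_real_derivative)
  have cont_affine: "continuous_on UNIV (\<lambda>x. flat_exp 1 (s * x + c))" for s c
    by (rule continuous_on_compose2[OF cont]) (auto intro!: continuous_intros)
  show "continuous_on UNIV ?\<phi>"
    by (intro continuous_on_mult cont_affine)
qed (auto simp: flat_exp_def)

lemma set_integrable_continuous_times_compact_support:
  fixes h \<phi> :: "real \<Rightarrow> complex"
  assumes h: "continuous_on {0<..} h" and \<phi>: "continuous_on UNIV \<phi>"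
    and "0 < a" "\<And>x. x \<notin> {a..b} \<Longrightarrow> \<phi> x = 0"
  shows "set_integrable lborel {0<..} (\<lambda>x. h x * \<phi> x)"
proof -
  have "integrable lborel (\<lambda>x. indicator {a..b} x *\<^sub>R (h x * \<phi> x))"
    by (intro borel_integrable_compact compact_Icc continuous_intros
        continuous_on_subset[OF h] continuous_on_subset[OF \<phi>]) (use \<open>0 < a\<close> in auto)
  also have "(\<lambda>x. indicator {a..b} x *\<^sub>R (h x * \<phi> x)) = (\<lambda>x. indicator {0<..} x *\<^sub>R (h x * \<phi> x))"
    using assms by (force simp: indicator_def)
  finally show ?thesis by (simp add: set_integrable_def)
qed

text \<open>If the difference \<open>d\<close> is nonzero at \<open>x0\<close>, it stays within half
  of its norm there on a small interval. Testing with a bump on that interval gives |d(x0)| times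
  the mass of the bump \<le> half of the same quantity, so the bump has mass 0, which is
  absurd.\<close>

lemma test_fun_pairing_determines_continuous:
  fixes h1 h2 :: "real \<Rightarrow> complex"
  assumes h1: "continuous_on {0<..} h1" and h2: "continuous_on {0<..} h2"
    and eq: "\<And>\<phi>. test_fun_Rplus \<phi> \<Longrightarrow>
      (LINT x:{0<..}|lborel. h1 x * \<phi> x) = (LINT x:{0<..}|lborel. h2 x * \<phi> x)"
    and "0 < x0"
  shows "h1 x0 = h2 x0"
proof (rule ccontr)
  assume ne: "h1 x0 \<noteq> h2 x0"
  define d where "d = (\<lambda>x. h1 x - h2 x)"
  have d0: "d x0 \<noteq> 0" using ne by (simp add: d_def)
  have "continuous_on {0<..} d" unfolding d_def by (intro continuous_intros h1 h2)
  then have "isCont d x0"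
    using \<open>0 < x0\<close> by (simp add: continuous_on_eq_continuous_at)
  then obtain \<delta> where \<delta>: "\<delta> > 0" "\<And>x. dist x x0 < \<delta> \<Longrightarrow> dist (d x) (d x0) < norm (d x0) / 2"
    using d0 unfolding continuous_at_eps_delta by (metis half_gt_zero zero_less_norm_iff)
  \<comment> \<open>The bound \<open>x0 / 2\<close> keeps the support of the bump inside the open
    half-line.\<close>
  define r where "r = min (\<delta> / 2) (x0 / 2)"
  have r: "0 < r" "r < \<delta>" "r < x0" using \<delta> \<open>0 < x0\<close> by (auto simp: r_def)
  obtain \<phi> where \<phi>: "test_fun_Rplus (\<lambda>x. complex_of_real (\<phi> x))" "continuous_on UNIV \<phi>"
    "\<And>x. 0 \<le> \<phi> x" "\<And>x. x0 - r < x \<Longrightarrow> x < x0 + r \<Longrightarrow> 0 < \<phi> x"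
    "\<And>x. x \<notin> {x0 - r..x0 + r} \<Longrightarrow> \<phi> x = 0"
    using test_fun_bump_exists[of "x0 - r" "x0 + r"] r by auto
  have int: "set_integrable lborel {0<..} (\<lambda>x. h x * complex_of_real (\<phi> x))"
    if "continuous_on {0<..} h" for h
    by (rule set_integrable_continuous_times_compact_support[of _ _ "x0 - r" "x0 + r"])
      (use that \<phi> r in \<open>auto intro!: continuous_intros\<close>)
  have \<phi>int: "integrable lborel \<phi>"
  proof -
    have "integrable lborel (\<lambda>x. indicator {x0 - r..x0 + r} x *\<^sub>R \<phi> x)"
      by (intro borel_integrable_compact compact_Icc continuous_on_subset[OF \<phi>(2)]) auto
    also have "(\<lambda>x. indicator {x0 - r..x0 + r} x *\<^sub>R \<phi> x) = \<phi>"
      using \<phi>(5) by (force simp: indicator_def)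
    finally show ?thesis .
  qed
  have "(LINT x:{0<..}|lborel. d x * complex_of_real (\<phi> x)) = 0"
    using eq[OF \<phi>(1)] int[OF h1] int[OF h2]
    by (simp add: d_def algebra_simps set_integral_diff)
  then have "(LINT x|lborel. d x0 * complex_of_real (\<phi> x)) =
      (LINT x|lborel. d x0 * complex_of_real (\<phi> x)) - (LINT x:{0<..}|lborel. d x * complex_of_real (\<phi> x))"
    by simp
  also have "\<dots> = (LINT x|lborel. d x0 * complex_of_real (\<phi> x) -
      indicator {0<..} x *\<^sub>R (d x * complex_of_real (\<phi> x)))"
    unfolding set_lebesgue_integral_def
    by (intro Bochner_Integration.integral_diff[symmetric] integrable_mult_right integrable_of_real \<phi>int)
      (use int[OF \<open>continuous_on {0<..} d\<close>] in \<open>simp add: set_integrable_def\<close>)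
  also have "norm \<dots> \<le> (LINT x|lborel. norm (d x0) / 2 * \<phi> x)"
  proof (rule Bochner_Integration.integral_norm_bound_integral)
    show "integrable lborel (\<lambda>x. d x0 * complex_of_real (\<phi> x) -
      indicator {0<..} x *\<^sub>R (d x * complex_of_real (\<phi> x)))"
      by (intro Bochner_Integration.integrable_diff integrable_mult_right integrable_of_real \<phi>int)
      (use int[OF \<open>continuous_on {0<..} d\<close>] in \<open>simp add: set_integrable_def\<close>)
    show "integrable lborel (\<lambda>x. norm (d x0) / 2 * \<phi> x)" using \<phi>int by simp
    fix x :: real
    show "norm (d x0 * complex_of_real (\<phi> x) - indicator {0<..} x *\<^sub>R (d x * complex_of_real (\<phi> x)))
        \<le> norm (d x0) / 2 * \<phi> x"
    proof (cases "x \<in> {x0 - r..x0 + r}")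
      case True
      then have "dist (d x) (d x0) < norm (d x0) / 2" and "x > 0"
        using r \<delta>(2)[of x] by (auto simp: dist_real_def)
      then have "norm ((d x0 - d x) * complex_of_real (\<phi> x)) \<le> norm (d x0) / 2 * \<phi> x"
        unfolding norm_mult using \<phi>(3)[of x]
        by (intro mult_mono) (auto simp: dist_norm norm_minus_commute)
      then show ?thesis using \<open>x > 0\<close> by (simp add: algebra_simps)
    next
      case False
      then show ?thesis using \<phi>(5) by simp
    qed
  qed
  finally have "norm (d x0) * \<bar>LINT x|lborel. \<phi> x\<bar> \<le> norm (d x0) / 2 * (LINT x|lborel. \<phi> x)"
    by (simp add: norm_mult)
  moreover have nonneg: "0 \<le> (LINT x|lborel. \<phi> x)"
    by (rule integral_nonneg_AE) (use \<phi>(3) in auto)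
  ultimately have "(LINT x|lborel. \<phi> x) \<le> 0"
    using d0 by (simp add: mult_le_0_iff)
  then have "(LINT x|lborel. \<phi> x) = 0"
    using nonneg by linarith
  then have "AE x in lborel. \<phi> x = 0"
    using integral_nonneg_eq_0_iff_AE[OF \<phi>int] \<phi>(3) by simp
  then have "AE x in lborel. x \<notin> {x0 - r<..<x0 + r}"
    by eventually_elim (use \<phi>(4) in force)
  then have "emeasure lborel {x0 - r<..<x0 + r} = 0"
    by (subst (asm) AE_iff_measurable[of "{x0 - r<..<x0 + r}"]) auto
  with r show False by simp
qed

section \<open>The jump kernel\<close>

lemma set_integrable_lborel_nonneg:
  fixes f :: "real \<Rightarrow> real"
  assumes [measurable]: "f \<in> borel_measurable borel" "S \<in> sets borel"
    and "f integrable_on S" "\<And>x. x \<in> S \<Longrightarrow> 0 \<le> f x"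
  shows "set_integrable lborel S f"
proof -
  have "f absolutely_integrable_on S"
    using assms by (intro nonnegative_absolutely_integrable_1) auto
  then show ?thesis
    unfolding set_integrable_def by (subst (asm) integrable_completion) auto
qed

text \<open>The common source of integrability for the kernel: \<open>a < b\<close> is the condition
  at 0 and \<open>0 < a\<close> the one at infinity. It is applied with (a, b) = (\<alpha>, 1) for
  the normalising constant, (1/2 + \<alpha>, 3) in the time variable and (2\<alpha>, 2) for the
  kernel itself.\<close>

lemma set_integrable_min_powr:
  fixes a b :: real
  assumes "0 < a" "a < b"
  shows "set_integrable lborel {0<..} (\<lambda>w. min 1 (w powr b) * w powr (- 1 - a))"
proof -
  have 1: "set_integrable lborel {0..1} (\<lambda>w::real. w powr (b - 1 - a))"
    by (intro set_integrable_lborel_nonneg integrable_on_powr_from_0) (use assms in auto)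
  have 2: "set_integrable lborel {1..} (\<lambda>w::real. w powr (- 1 - a))"
    using has_integral_powr_to_inf[of "-1-a" 1] assms
    by (intro set_integrable_lborel_nonneg) (auto simp: integrable_on_def)
  have "integrable lborel (\<lambda>w::real. indicator {0..1} w *\<^sub>R w powr (b - 1 - a) + indicator {1..} w *\<^sub>R w powr (- 1 - a))"
    using 1 2 unfolding set_integrable_def by (rule Bochner_Integration.integrable_add)
  then show ?thesis
    unfolding set_integrable_def
  proof (rule Bochner_Integration.integrable_bound)
    show "AE w in lborel. norm (indicator {0<..} w *\<^sub>R (min 1 (w powr b) * w powr (- 1 - a)))
        \<le> norm (indicator {0..1} w *\<^sub>R w powr (b - 1 - a) + indicator {1..} w *\<^sub>R w powr (- 1 - a))"
    proof (rule AE_I2)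
      fix w :: real
      have "w powr b * w powr (- 1 - a) = w powr (b - 1 - a)"
        by (simp flip: powr_add add: algebra_simps)
      moreover have "min 1 (w powr b) * w powr (- 1 - a) \<le> w powr b * w powr (- 1 - a)"
        "min 1 (w powr b) * w powr (- 1 - a) \<le> 1 * w powr (- 1 - a)"
        by (intro mult_right_mono; simp)+
      ultimately show "norm (indicator {0<..} w *\<^sub>R (min 1 (w powr b) * w powr (- 1 - a)))
        \<le> norm (indicator {0..1} w *\<^sub>R w powr (b - 1 - a) + indicator {1..} w *\<^sub>R w powr (- 1 - a))"
        by (auto simp: indicator_def)
    qed
  qed measurable
qed

lemma lborel_integral_fold:
  fixes f :: "real \<Rightarrow> 'a::{banach, second_countable_topology}"
  assumes "integrable lborel f"
  shows "set_integrable lborel {0<..} (\<lambda>w. f w + f (- w))"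
    and "(LINT w|lborel. f w) = (LINT w:{0<..}|lborel. f w + f (- w))"
proof -
  have [measurable]: "f \<in> borel_measurable borel"
    using assms by auto
  have pos: "integrable lborel (\<lambda>w. indicator {0<..} w *\<^sub>R f w)"
    and neg: "integrable lborel (\<lambda>w. indicator {..<0} w *\<^sub>R f w)"
    by (intro integrable_mult_indicator assms; simp)+
  have eq: "(\<lambda>w. indicator {..<0::real} (0 + (- 1) * w) *\<^sub>R f (0 + (- 1) * w)) =
      (\<lambda>w. indicator {0<..} w *\<^sub>R f (- w))"
    by (auto simp: indicator_def)
  have neg': "integrable lborel (\<lambda>w. indicator {0<..} w *\<^sub>R f (- w))"
    using lborel_integrable_real_affine[OF neg, of "- 1" 0] unfolding eq by simp
  show "set_integrable lborel {0<..} (\<lambda>w. f w + f (- w))"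
    unfolding set_integrable_def scaleR_add_right by (intro Bochner_Integration.integrable_add pos neg')
  have "(LINT w|lborel. f w) = (LINT w|lborel. indicator {0<..} w *\<^sub>R f w + indicator {..<0} w *\<^sub>R f w)"
    using AE_lborel_singleton[of "0::real"]
    by (intro integral_cong_AE) (auto elim!: eventually_mono simp: indicator_def)
  also have "\<dots> = (LINT w|lborel. indicator {0<..} w *\<^sub>R f w) + (LINT w|lborel. indicator {..<0} w *\<^sub>R f w)"
    by (intro Bochner_Integration.integral_add pos neg)
  also have "(LINT w|lborel. indicator {..<0} w *\<^sub>R f w) = (LINT w|lborel. indicator {0<..} w *\<^sub>R f (- w))"
    using lborel_integral_real_affine[of "- 1" "\<lambda>w. indicator {..<0} w *\<^sub>R f w" 0] unfolding eq by simp
  also have "(LINT w|lborel. indicator {0<..} w *\<^sub>R f w) + \<dots> = (LINT w:{0<..}|lborel. f w + f (- w))"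
    unfolding set_lebesgue_integral_def scaleR_add_right
    by (intro Bochner_Integration.integral_add[symmetric] pos neg')
  finally show "(LINT w|lborel. f w) = (LINT w:{0<..}|lborel. f w + f (- w))" .
qed

text \<open>Rescaling by \<sigma> reduces this to the characteristic function of the standard normal
  distribution.\<close>

lemma integral_iexp_normal_density:
  assumes "\<sigma> > 0"
  shows "integrable lborel (\<lambda>w. iexp (\<xi> * w) * complex_of_real (normal_density 0 \<sigma> w))"
    and "(LINT w|lborel. iexp (\<xi> * w) * complex_of_real (normal_density 0 \<sigma> w)) =
      complex_of_real (exp (- (\<sigma>\<^sup>2 * \<xi>\<^sup>2 / 2)))"
proof -
  show "integrable lborel (\<lambda>w. iexp (\<xi> * w) * complex_of_real (normal_density 0 \<sigma> w))"
    by (rule Bochner_Integration.integrable_bound[OF integrable_normal_density[OF assms, of 0]])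
      (auto simp: norm_mult)
  have "complex_of_real (exp (- ((\<sigma> * \<xi>)\<^sup>2) / 2)) = char std_normal_distribution (\<sigma> * \<xi>)"
    by (simp add: char_std_normal_distribution)
  also have "\<dots> = (LINT x|lborel. normal_density 0 1 x *\<^sub>R iexp (\<sigma> * \<xi> * x))"
    unfolding char_def by (subst integral_density) auto
  also have "\<dots> = (LINT x|lborel. \<sigma> *\<^sub>R (iexp (\<xi> * (0 + \<sigma> * x)) * complex_of_real (normal_density 0 \<sigma> (0 + \<sigma> * x))))"
    using assms by (intro Bochner_Integration.integral_cong refl)
      (simp add: normal_density_def real_sqrt_mult power_mult_distrib scaleR_conv_of_real mult_ac)
  also have "\<dots> = (LINT w|lborel. iexp (\<xi> * w) * complex_of_real (normal_density 0 \<sigma> w))"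
    using assms
    by (subst (2) lborel_integral_real_affine[of \<sigma> _ 0]) (auto simp del: add_0)
  finally show "(LINT w|lborel. iexp (\<xi> * w) * complex_of_real (normal_density 0 \<sigma> w)) =
      complex_of_real (exp (- (\<sigma>\<^sup>2 * \<xi>\<^sup>2 / 2)))"
    by (simp add: power_mult_distrib)
qed

lemma integral_one_minus_cos_normal_density:
  assumes "\<sigma> > 0"
  shows "(LINT w:{0<..}|lborel. (1 - cos (\<xi> * w)) * normal_density 0 \<sigma> w) = (1 - exp (- (\<sigma>\<^sup>2 * \<xi>\<^sup>2 / 2))) / 2"
proof -
  have cos: "cos (\<xi> * w) * normal_density 0 \<sigma> w = Re (iexp (\<xi> * w) * complex_of_real (normal_density 0 \<sigma> w))" for w
    by (simp add: Re_exp)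
  have int_cos: "integrable lborel (\<lambda>w. cos (\<xi> * w) * normal_density 0 \<sigma> w)"
    unfolding cos by (intro integrable_Re integral_iexp_normal_density(1)[OF assms])
  have "(LINT w|lborel. cos (\<xi> * w) * normal_density 0 \<sigma> w) = exp (- (\<sigma>\<^sup>2 * \<xi>\<^sup>2 / 2))"
    unfolding cos by (subst integral_Re)
      (use integral_iexp_normal_density[OF assms, of \<xi>] in auto)
  then have "(LINT w|lborel. (1 - cos (\<xi> * w)) * normal_density 0 \<sigma> w) = 1 - exp (- (\<sigma>\<^sup>2 * \<xi>\<^sup>2 / 2))"
    using int_cos integral_normal_density[OF assms, of 0] integrable_normal_density[OF assms, of 0]
    by (simp add: left_diff_distrib)
  moreover have "integrable lborel (\<lambda>w. (1 - cos (\<xi> * w)) * normal_density 0 \<sigma> w)"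
    using int_cos integrable_normal_density[OF assms, of 0] by (simp add: left_diff_distrib)
  then have "(LINT w|lborel. (1 - cos (\<xi> * w)) * normal_density 0 \<sigma> w) =
      (LINT w:{0<..}|lborel. 2 * ((1 - cos (\<xi> * w)) * normal_density 0 \<sigma> w))"
    by (subst lborel_integral_fold) (auto simp: normal_density_def)
  ultimately show ?thesis by simp
qed

text \<open>The kernel comes from subordination: \<open>levy_const \<alpha> * s\<^sup>\<alpha>\<close> is the integral of
  \<open>(1 - exp (- s t)) t\<^bsup>-1-\<alpha>\<^esup>\<close> over \<open>t > 0\<close>, taken at \<open>s = 1 + \<xi>\<^sup>2\<close>, and the
  normal density with variance \<open>2 t\<close> is the heat kernel at time \<open>t\<close>. Normalising by
  \<open>levy_const\<close> instead of its value \<open>\<Gamma>(1 - \<alpha>) / \<alpha>\<close> avoids the Gamma function.\<close>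

definition levy_const :: "real \<Rightarrow> real" where
  "levy_const \<alpha> = (LINT t:{0<..}|lborel. (1 - exp (- t)) * t powr (- 1 - \<alpha>))"

definition levy_integrand :: "real \<Rightarrow> real \<Rightarrow> real \<Rightarrow> real" where
  "levy_integrand \<alpha> t w = exp (- t) * (t powr (- 1 - \<alpha>) * normal_density 0 (sqrt (2 * t)) w)"

definition levy_kernel :: "real \<Rightarrow> real \<Rightarrow> real" where
  "levy_kernel \<alpha> w = (LINT t:{0<..}|lborel. levy_integrand \<alpha> t w) / levy_const \<alpha>"

lemma levy_integrand_measurable [measurable]:
  "(\<lambda>(t, w). levy_integrand \<alpha> t w) \<in> borel_measurable (borel \<Otimes>\<^sub>M borel)"
  unfolding levy_integrand_def normal_density_def by measurable

lemma levy_integrand_measurable_fst [measurable]: "(\<lambda>t. levy_integrand \<alpha> t w) \<in> borel_measurable borel"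
  unfolding levy_integrand_def normal_density_def by measurable

lemma levy_kernel_measurable [measurable]: "levy_kernel \<alpha> \<in> borel_measurable borel"
  unfolding levy_kernel_def set_lebesgue_integral_def by measurable

lemma levy_const_integrable:
  fixes \<alpha> :: real
  assumes "0 < \<alpha>" "\<alpha> < 1"
  shows "set_integrable lborel {0<..} (\<lambda>t. (1 - exp (- t)) * t powr (- 1 - \<alpha>))"
  unfolding set_integrable_def
proof (rule Bochner_Integration.integrable_bound)
  show "integrable lborel (\<lambda>t::real. indicator {0<..} t *\<^sub>R (min 1 (t powr 1) * t powr (- 1 - \<alpha>)))"
    using set_integrable_min_powr[of \<alpha> 1] assms by (simp add: set_integrable_def)
  have "(1 - exp (- t)) * t powr (- 1 - \<alpha>) \<le> min 1 t * t powr (- 1 - \<alpha>)" if "t > 0" for t :: real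
    using exp_ge_add_one_self[of "- t"] by (intro mult_right_mono) auto
  then show "AE t in lborel. norm (indicator {0<..} t *\<^sub>R ((1 - exp (- t)) * t powr (- 1 - \<alpha>)))
      \<le> norm (indicator {0<..} t *\<^sub>R (min 1 (t powr 1) * t powr (- 1 - \<alpha>)))"
    by (auto simp: indicator_def abs_mult)
qed measurable

lemma levy_const_pos:
  assumes "0 < \<alpha>" "\<alpha> < 1"
  shows "levy_const \<alpha> > 0"
proof -
  let ?f = "\<lambda>t::real. indicator {0<..} t *\<^sub>R ((1 - exp (- t)) * t powr (- 1 - \<alpha>))"
  have int: "integrable lborel ?f"
    using levy_const_integrable[OF assms] by (simp add: set_integrable_def)
  have nonneg: "0 \<le> ?f t" for t
    by (auto simp: indicator_def)
  have "integral\<^sup>L lborel ?f \<noteq> 0"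
  proof
    assume "integral\<^sup>L lborel ?f = 0"
    then have "AE t in lborel. ?f t = 0"
      using integral_nonneg_eq_0_iff_AE[OF int] nonneg by simp
    then have "AE t in lborel. t \<notin> {0<..<1::real}"
      by eventually_elim (auto simp: indicator_def)
    then have "emeasure lborel {0<..<1::real} = 0"
      by (subst (asm) AE_iff_measurable[of "{0<..<1::real}"]) auto
    then show False by simp
  qed
  moreover have "0 \<le> integral\<^sup>L lborel ?f"
    by (intro integral_nonneg_AE AE_I2 nonneg)
  ultimately show ?thesis
    by (simp add: levy_const_def set_lebesgue_integral_def)
qed

text \<open>Under the substitution of s t for t the measure contributes s and the power contributes
  s^(-1-\<alpha>), hence s^(-\<alpha>) in total.\<close>

lemma levy_const_scaled:
  assumes "0 < \<alpha>" "\<alpha> < 1" "0 < s"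
  shows "set_integrable lborel {0<..} (\<lambda>t. (1 - exp (- (s * t))) * t powr (- 1 - \<alpha>))"
    and "(LINT t:{0<..}|lborel. (1 - exp (- (s * t))) * t powr (- 1 - \<alpha>)) = s powr \<alpha> * levy_const \<alpha>"
proof -
  let ?f = "\<lambda>t::real. indicator {0<..} t *\<^sub>R ((1 - exp (- t)) * t powr (- 1 - \<alpha>))"
  let ?g = "\<lambda>t::real. indicator {0<..} t *\<^sub>R ((1 - exp (- (s * t))) * t powr (- 1 - \<alpha>))"
  have eq: "?f (0 + s * t) = s powr (- 1 - \<alpha>) * ?g t" for t
    using \<open>0 < s\<close> by (auto simp: indicator_def zero_less_mult_iff powr_mult)
  have int: "integrable lborel ?f"
    using levy_const_integrable[OF assms(1,2)] by (simp add: set_integrable_def)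
  from lborel_integrable_real_affine[OF this, of s 0] have "integrable lborel (\<lambda>t. s powr (- 1 - \<alpha>) * ?g t)"
    unfolding eq using \<open>0 < s\<close> by simp
  then show "set_integrable lborel {0<..} (\<lambda>t. (1 - exp (- (s * t))) * t powr (- 1 - \<alpha>))"
    unfolding set_integrable_def using \<open>0 < s\<close> by (subst (asm) integrable_mult_left_iff) auto
  have "levy_const \<alpha> = s * (LINT t|lborel. s powr (- 1 - \<alpha>) * ?g t)"
    using lborel_integral_real_affine[of s ?f 0] \<open>0 < s\<close> unfolding eq
    by (simp add: levy_const_def set_lebesgue_integral_def)
  also have "\<dots> = s powr (- \<alpha>) * (LINT t|lborel. ?g t)"
  proof -
    have "s * s powr (- 1 - \<alpha>) = s powr (- \<alpha>)"
      using \<open>0 < s\<close> by (simp add: powr_mult_base)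
    then show ?thesis
      unfolding integral_mult_right_zero mult.assoc[symmetric] by simp
  qed
  finally show "(LINT t:{0<..}|lborel. (1 - exp (- (s * t))) * t powr (- 1 - \<alpha>)) = s powr \<alpha> * levy_const \<alpha>"
    using \<open>0 < s\<close> by (simp add: set_lebesgue_integral_def powr_minus field_simps)
qed

section \<open>Size of the kernel near 0 and at infinity\<close>

lemma exp_minus_inverse_le_cube:
  fixes t :: real
  assumes "t > 0"
  shows "exp (- (1 / (4 * t))) \<le> 1728 * min 1 (t powr 3)"
proof -
  \<comment> \<open>The constant 1728 is 12^3: cubing y \<le> exp y at y = 1/(12 t) produces
    exp(1/(4 t)). The resulting t^3 beats the factor t^(-3/2-\<alpha>) of the heat density at t = 0,
    because 3 > 1/2 + \<alpha>.\<close>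
  have "1 / (12 * t) \<le> exp (1 / (12 * t))"
    using exp_ge_add_one_self[of "1 / (12 * t)"] by linarith
  then have "(1 / (12 * t)) ^ 3 \<le> exp (1 / (12 * t)) ^ 3"
    using assms by (intro power_mono) auto
  also have "\<dots> = exp (1 / (4 * t))"
    by (simp flip: exp_of_nat_mult)
  finally have "exp (- (1 / (4 * t))) \<le> 1728 * t ^ 3"
    using assms by (simp add: exp_minus field_simps power3_eq_cube)
  moreover have "exp (- (1 / (4 * t))) \<le> 1"
    using assms by simp
  moreover have "t powr 3 = t ^ 3"
    using assms by (simp add: powr_numeral)
  ultimately show ?thesis
    by linarith
qed

lemma integrable_min_cube:
  "0 < \<alpha> \<Longrightarrow> \<alpha> < 1 \<Longrightarrow>
    integrable lborel (\<lambda>t::real. indicator {0<..} t *\<^sub>R (min 1 (t powr 3) * t powr (- 1 - (1 / 2 + \<alpha>))))"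
  using set_integrable_min_powr[of "1 / 2 + \<alpha>" 3] by (simp add: set_integrable_def)

text \<open>The prefactor 1/sqrt(4 \<pi> t) of the density merges with t^(-1-\<alpha>). The exponent
  is left as \<open>- 1 - (1 / 2 + \<alpha>)\<close> to match the shape required by
  \<open>set_integrable_min_powr\<close>.\<close>

lemma heat_density_eq:
  assumes "t > 0"
  shows "t powr (- 1 - \<alpha>) * normal_density 0 (sqrt (2 * t)) w =
    1 / sqrt (4 * pi) * t powr (- 1 - (1 / 2 + \<alpha>)) * exp (- (w\<^sup>2 / (4 * t)))"
proof -
  have "t powr (- 1 - (1 / 2 + \<alpha>)) = t powr (- 1 - \<alpha>) / sqrt t"
    using powr_diff[of t "- 1 - \<alpha>" "1 / 2"] assms by (simp add: powr_half_sqrt algebra_simps)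
  then show ?thesis
    using assms by (simp add: normal_density_def real_sqrt_mult power_mult_distrib)
qed

lemma heat_density_one_le:
  assumes "t > 0"
  shows "t powr (- 1 - \<alpha>) * normal_density 0 (sqrt (2 * t)) 1
    \<le> 1728 / sqrt (4 * pi) * (min 1 (t powr 3) * t powr (- 1 - (1 / 2 + \<alpha>)))"
proof -
  have "1 / sqrt (4 * pi) * t powr (- 1 - (1 / 2 + \<alpha>)) * exp (- (1\<^sup>2 / (4 * t)))
     \<le> 1 / sqrt (4 * pi) * t powr (- 1 - (1 / 2 + \<alpha>)) * (1728 * min 1 (t powr 3))"
    using exp_minus_inverse_le_cube[OF assms] by (intro mult_left_mono) auto
  then show ?thesis
    unfolding heat_density_eq[OF assms] by (simp add: mult_ac)
qed

text \<open>Without the damping exp(-t) the integral is exactly homogeneous: t = w^2 s turns the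
  integrand at w into w^(-3-2\<alpha>) times the integrand at 1, and dt contributes w^2. So
  integrability has to be checked only at w = 1, and the integral there supplies the constant; this
  is the kernel of the fractional Laplacian up to a factor.\<close>

lemma heat_density_integral_le:
  assumes "0 < \<alpha>" "\<alpha> < 1"
  shows "\<exists>C\<ge>0. \<forall>w>0. set_integrable lborel {0<..} (\<lambda>t. t powr (- 1 - \<alpha>) * normal_density 0 (sqrt (2 * t)) w) \<and>
     (LINT t:{0<..}|lborel. t powr (- 1 - \<alpha>) * normal_density 0 (sqrt (2 * t)) w) \<le> C * w powr (- 1 - 2 * \<alpha>)"
proof -
  define K :: "real \<Rightarrow> real \<Rightarrow> real" where
    "K t w = indicator {0<..} t *\<^sub>R (t powr (- 1 - \<alpha>) * normal_density 0 (sqrt (2 * t)) w)" for t w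
  have K1: "integrable lborel (\<lambda>t. K t 1)"
  proof (rule Bochner_Integration.integrable_bound)
    show "integrable lborel (\<lambda>t. 1728 / sqrt (4 * pi) *
        (indicator {0<..} t *\<^sub>R (min 1 (t powr 3) * t powr (- 1 - (1 / 2 + \<alpha>)))))"
      by (intro integrable_mult_right integrable_min_cube assms)
    have "K t 1 \<le> 1728 / sqrt (4 * pi) *
        (indicator {0<..} t *\<^sub>R (min 1 (t powr 3) * t powr (- 1 - (1 / 2 + \<alpha>))))" for t
      using heat_density_one_le[of t \<alpha>] by (auto simp: K_def indicator_def)
    moreover have "0 \<le> K t 1" for t
      by (auto simp: K_def)
    ultimately show "AE t in lborel. norm (K t 1) \<le> norm (1728 / sqrt (4 * pi) *
        (indicator {0<..} t *\<^sub>R (min 1 (t powr 3) * t powr (- 1 - (1 / 2 + \<alpha>)))))"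
      by (intro AE_I2) (metis abs_of_nonneg order_trans real_norm_def)
  qed (auto simp: K_def normal_density_def)
  have scale: "K (0 + w\<^sup>2 * s) w = w powr (- 3 - 2 * \<alpha>) * K s 1" if "w > 0" for s w
  proof (cases "s > 0")
    case True
    have "(w\<^sup>2) powr (- 1 - (1 / 2 + \<alpha>)) = w powr (- 3 - 2 * \<alpha>)"
      using that powr_powr[of w 2 "- 1 - (1 / 2 + \<alpha>)"] by (simp add: powr_numeral)
    moreover have pos: "w\<^sup>2 * s > 0" using that True by simp
    ultimately show ?thesis
      using that True heat_density_eq[OF pos, of \<alpha> w] heat_density_eq[OF True, of \<alpha> 1]
      unfolding K_def powr_mult[of "w\<^sup>2" s "- 1 - (1 / 2 + \<alpha>)"] by simp
  qed (use that in \<open>auto simp: K_def zero_less_mult_iff\<close>)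
  have "integrable lborel (\<lambda>t. K t w) \<and>
      (LINT t|lborel. K t w) \<le> \<bar>LINT t|lborel. K t 1\<bar> * w powr (- 1 - 2 * \<alpha>)" if "w > 0" for w
  proof -
    have "integrable lborel (\<lambda>s. K (0 + w\<^sup>2 * s) w)"
      unfolding scale[OF that] by (intro integrable_mult_right K1)
    then have "integrable lborel (\<lambda>t. K t w)"
      using that by (subst (asm) lborel_integrable_real_affine_iff) auto
    moreover have "(LINT t|lborel. K t w) = w\<^sup>2 * (LINT s|lborel. w powr (- 3 - 2 * \<alpha>) * K s 1)"
      by (subst lborel_integral_real_affine[of "w\<^sup>2" _ 0]) (use that scale[OF that] in auto)
    moreover have "w\<^sup>2 * w powr (- 3 - 2 * \<alpha>) = w powr (- 1 - 2 * \<alpha>)"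
      using that by (simp flip: powr_numeral powr_add)
    ultimately have "(LINT t|lborel. K t w) = (LINT s|lborel. K s 1) * w powr (- 1 - 2 * \<alpha>)"
      by (simp only: integral_mult_right_zero mult.assoc[symmetric]) (simp add: mult.commute)
    with \<open>integrable lborel (\<lambda>t. K t w)\<close> show ?thesis
      by (auto intro!: mult_right_mono)
  qed
  then show ?thesis
    \<comment> \<open>The absolute value makes the witness nonnegative without a separate sign
      argument.\<close>
    unfolding set_integrable_def set_lebesgue_integral_def K_def by (intro exI[of _ "\<bar>LINT t|lborel. K t 1\<bar>"]) (simp add: K_def)
qed

lemma levy_integrand_nonneg: "0 \<le> levy_integrand \<alpha> t w"
  by (simp add: levy_integrand_def)

lemma levy_integrand_integrable:
  assumes "0 < \<alpha>" "\<alpha> < 1" "w > 0"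
  shows "set_integrable lborel {0<..} (\<lambda>t. levy_integrand \<alpha> t w)"
  unfolding set_integrable_def
proof (rule Bochner_Integration.integrable_bound)
  show "integrable lborel (\<lambda>t. indicator {0<..} t *\<^sub>R (t powr (- 1 - \<alpha>) * normal_density 0 (sqrt (2 * t)) w))"
    using heat_density_integral_le[OF assms(1,2)] assms(3) by (auto simp: set_integrable_def)
  show "AE t in lborel. norm (indicator {0<..} t *\<^sub>R levy_integrand \<alpha> t w)
      \<le> norm (indicator {0<..} t *\<^sub>R (t powr (- 1 - \<alpha>) * normal_density 0 (sqrt (2 * t)) w))"
    by (auto simp: indicator_def levy_integrand_def abs_mult intro!: mult_left_le_one_le)
qed measurable

text \<open>This covers every real w, also w = 0, where the integral over t diverges and the Bochner
  integral takes its default value 0.\<close>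

lemma levy_kernel_nonneg: "0 < \<alpha> \<Longrightarrow> \<alpha> < 1 \<Longrightarrow> 0 \<le> levy_kernel \<alpha> w"
  unfolding levy_kernel_def set_lebesgue_integral_def
  by (intro divide_nonneg_nonneg integral_nonneg_AE AE_I2 less_imp_le[OF levy_const_pos])
    (auto simp: levy_integrand_nonneg)

text \<open>Dropping exp(-t) \<le> 1 leaves the homogeneous integral.\<close>

lemma levy_kernel_le_powr:
  assumes "0 < \<alpha>" "\<alpha> < 1"
  shows "\<exists>C\<ge>0. \<forall>w>0. levy_kernel \<alpha> w \<le> C * w powr (- 1 - 2 * \<alpha>)"
proof -
  obtain C where C: "C \<ge> 0" "\<And>w. w > 0 \<Longrightarrow> set_integrable lborel {0<..} (\<lambda>t. t powr (- 1 - \<alpha>) * normal_density 0 (sqrt (2 * t)) w)"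
    "\<And>w. w > 0 \<Longrightarrow> (LINT t:{0<..}|lborel. t powr (- 1 - \<alpha>) * normal_density 0 (sqrt (2 * t)) w) \<le> C * w powr (- 1 - 2 * \<alpha>)"
    using heat_density_integral_le[OF assms] by blast
  have "levy_kernel \<alpha> w \<le> C / levy_const \<alpha> * w powr (- 1 - 2 * \<alpha>)" if "w > 0" for w
  proof -
    have "(LINT t:{0<..}|lborel. levy_integrand \<alpha> t w) \<le>
        (LINT t:{0<..}|lborel. t powr (- 1 - \<alpha>) * normal_density 0 (sqrt (2 * t)) w)"
      by (intro set_integral_mono levy_integrand_integrable assms that C(2))
        (auto simp: levy_integrand_def intro!: mult_left_le_one_le)
    also note C(3)[OF that]
    finally show ?thesis
      unfolding levy_kernel_def using levy_const_pos[OF assms] by (simp add: divide_right_mono)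
  qed
  then show ?thesis
    using C(1) levy_const_pos[OF assms] by (intro exI[of _ "C / levy_const \<alpha>"]) auto
qed

text \<open>Completing the square, w^2/(4t) + t = w + (w/2 - t)^2/t, so exp(-w) splits off. The
  remaining exponential must still be integrable against t^(-3/2-\<alpha>) near t = 0, for which
  exp(-1/(4t)) is kept. For t \<le> 1 the threshold w \<ge> 4 gives w/2 - t \<ge> 1, so the square
  dominates 1/(4t); for t > 1 the quantity 1/(4t) is bounded and the factor exp(1/2) compensates
  it.\<close>

lemma levy_kernel_le_exp:
  assumes "0 < \<alpha>" "\<alpha> < 1"
  shows "\<exists>C\<ge>0. \<forall>w\<ge>4. levy_kernel \<alpha> w \<le> C * exp (- w)"
proof -
  let ?g = "\<lambda>t::real. indicator {0<..} t *\<^sub>R (min 1 (t powr 3) * t powr (- 1 - (1 / 2 + \<alpha>)))"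
  define c where "c = exp (1 / 2) * 1728 / sqrt (4 * pi)"
  have c: "c \<ge> 0" by (simp add: c_def)
  have "levy_kernel \<alpha> w \<le> c * \<bar>LINT t|lborel. ?g t\<bar> / levy_const \<alpha> * exp (- w)" if w: "w \<ge> 4" for w
  proof -
    have le: "levy_integrand \<alpha> t w \<le> exp (- w) * (c * (min 1 (t powr 3) * t powr (- 1 - (1 / 2 + \<alpha>))))"
      if t: "t > 0" for t
    proof -
      define r where "r = exp (- (w\<^sup>2 / (4 * t)) - t + w)"
      have eq: "w\<^sup>2 / (4 * t) + t - w = (w / 2 - t)\<^sup>2 / t"
        using t by (simp add: field_simps power2_eq_square)
      have "r \<le> exp (1 / 2) * exp (- (1 / (4 * t)))"
      proof (cases "t \<le> 1")
        case True
        then have "1 \<le> (w / 2 - t)\<^sup>2"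
          using w by (intro one_le_power) auto
        then have "1 / (4 * t) \<le> (w / 2 - t)\<^sup>2 / t"
          using t by (simp add: field_simps)
        then show ?thesis
          unfolding r_def using eq by (simp flip: exp_add)
      next
        case False
        then have "1 / (4 * t) \<le> 1 / 2" by (simp add: field_simps)
        moreover have "0 \<le> (w / 2 - t)\<^sup>2 / t" using t by simp
        ultimately show ?thesis
          unfolding r_def using eq by (simp flip: exp_add)
      qed
      also have "\<dots> \<le> exp (1 / 2) * (1728 * min 1 (t powr 3))"
        by (intro mult_left_mono exp_minus_inverse_le_cube t) auto
      finally have r: "r \<le> exp (1 / 2) * (1728 * min 1 (t powr 3))" .
      have "exp (- t) * exp (- (w\<^sup>2 / (4 * t))) = exp (- w) * r"
        by (simp add: r_def flip: exp_add)
      then have "levy_integrand \<alpha> t w = exp (- w) * (1 / sqrt (4 * pi) * t powr (- 1 - (1 / 2 + \<alpha>)) * r)"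
        unfolding levy_integrand_def heat_density_eq[OF t] by (simp add: mult_ac)
      also have "\<dots> \<le> exp (- w) * (1 / sqrt (4 * pi) * t powr (- 1 - (1 / 2 + \<alpha>)) * (exp (1 / 2) * (1728 * min 1 (t powr 3))))"
        by (intro mult_left_mono r) auto
      also have "\<dots> = exp (- w) * (c * (min 1 (t powr 3) * t powr (- 1 - (1 / 2 + \<alpha>))))"
        by (simp add: c_def)
      finally show ?thesis .
    qed
    have "(LINT t:{0<..}|lborel. levy_integrand \<alpha> t w) \<le> (LINT t|lborel. exp (- w) * (c * ?g t))"
      unfolding set_lebesgue_integral_def
    proof (rule integral_mono)
      show "integrable lborel (\<lambda>t. indicator {0<..} t *\<^sub>R levy_integrand \<alpha> t w)"
        using levy_integrand_integrable[OF assms, of w] w by (simp add: set_integrable_def)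
      show "integrable lborel (\<lambda>t. exp (- w) * (c * ?g t))"
        by (intro integrable_mult_right integrable_min_cube assms)
      show "indicator {0<..} t *\<^sub>R levy_integrand \<alpha> t w \<le> exp (- w) * (c * ?g t)" for t
        using le[of t] by (auto simp: indicator_def)
    qed
    also have "\<dots> \<le> c * \<bar>LINT t|lborel. ?g t\<bar> * exp (- w)"
      using c by (simp add: mult_ac mult_left_mono)
    finally show ?thesis
      unfolding levy_kernel_def using levy_const_pos[OF assms] by (simp add: divide_right_mono)
  qed
  then show ?thesis
    using c levy_const_pos[OF assms] by (intro exI[of _ "c * \<bar>LINT t|lborel. ?g t\<bar> / levy_const \<alpha>"]) auto
qed

text \<open>The Levy measure condition. With the power bound it amounts to 0 < 2\<alpha> <
  2.\<close>

lemma levy_kernel_integrable: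
  assumes "0 < \<alpha>" "\<alpha> < 1"
  shows "set_integrable lborel {0<..} (\<lambda>w. min 1 (w\<^sup>2) * levy_kernel \<alpha> w)"
proof -
  obtain C where C: "C \<ge> 0" "\<And>w. w > 0 \<Longrightarrow> levy_kernel \<alpha> w \<le> C * w powr (- 1 - 2 * \<alpha>)"
    using levy_kernel_le_powr[OF assms] by blast
  show ?thesis
    unfolding set_integrable_def
  proof (rule Bochner_Integration.integrable_bound)
    show "integrable lborel (\<lambda>w. C * (indicator {0<..} w *\<^sub>R (min 1 (w powr 2) * w powr (- 1 - 2 * \<alpha>))))"
      using set_integrable_min_powr[of "2 * \<alpha>" 2] assms by (simp add: set_integrable_def)
    have "min 1 (w\<^sup>2) * levy_kernel \<alpha> w \<le> C * (min 1 (w powr 2) * w powr (- 1 - 2 * \<alpha>))" if "w > 0" for w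
    proof -
      have "min 1 (w\<^sup>2) * levy_kernel \<alpha> w \<le> min 1 (w\<^sup>2) * (C * w powr (- 1 - 2 * \<alpha>))"
        using C(2)[OF that] by (intro mult_left_mono) auto
      then show ?thesis using that by (simp add: mult_ac powr_numeral)
    qed
    then show "AE w in lborel. norm (indicator {0<..} w *\<^sub>R (min 1 (w\<^sup>2) * levy_kernel \<alpha> w))
        \<le> norm (C * (indicator {0<..} w *\<^sub>R (min 1 (w powr 2) * w powr (- 1 - 2 * \<alpha>))))"
      using C(1) levy_kernel_nonneg[OF assms] by (auto simp: indicator_def abs_mult)
  qed measurable
qed

text \<open>The constant adds two bounds: 1 - cos \<le> 2 for large w, and 1 - cos(\<xi> w) = 2
  sin(\<xi> w/2)^2 \<le> \<xi>^2 w^2/2 for small w. The form separates \<xi> from w, as a product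
  majorant requires.\<close>

lemma one_minus_cos_le: "1 - cos (\<xi> * w) \<le> (2 + \<xi>\<^sup>2) * min 1 (w\<^sup>2)" for \<xi> w :: real
proof -
  have "(sin (\<xi> * w / 2))\<^sup>2 \<le> (\<xi> * w / 2)\<^sup>2"
    using abs_sin_x_le_abs_x[of "\<xi> * w / 2"] by (simp only: abs_le_square_iff)
  moreover have "1 - cos (\<xi> * w) = 2 * (sin (\<xi> * w / 2))\<^sup>2"
    using cos_double_sin[of "\<xi> * w / 2"] by simp
  ultimately have le: "1 - cos (\<xi> * w) \<le> \<xi>\<^sup>2 * w\<^sup>2 / 2"
    using zero_le_power2[of "sin (\<xi> * w / 2)"] by (simp add: power_mult_distrib power_divide)
  have nonneg: "0 \<le> \<xi>\<^sup>2" "0 \<le> w\<^sup>2" "0 \<le> \<xi>\<^sup>2 * w\<^sup>2" by auto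
  show ?thesis
  proof (cases "1 \<le> w\<^sup>2")
    case True
    then show ?thesis
      using nonneg(1) cos_ge_minus_one[of "\<xi> * w"] by (simp only: min_absorb1 mult_1_right)
  next
    case False
    then have "min 1 (w\<^sup>2) = w\<^sup>2" by simp
    then show ?thesis
      using nonneg le by (simp only: distrib_right)
  qed
qed

text \<open>The double integral of (1 - cos(\<xi> w)) against \<open>levy_integrand\<close> is
  evaluated in both orders. Integrating over t first gives the kernel; integrating over w first
  gives Gaussian transforms. The nonnegative integrand makes Fubini depend only on the integral
  already bounded in \<open>int\<close>.\<close>

lemma levy_symbol:
  assumes "0 < \<alpha>" "\<alpha> < 1"
  shows "set_integrable lborel {0<..} (\<lambda>w. (1 - cos (\<xi> * w)) * levy_kernel \<alpha> w)"
    and "1 + 2 * (LINT w:{0<..}|lborel. (1 - cos (\<xi> * w)) * levy_kernel \<alpha> w) = (1 + \<xi>\<^sup>2) powr \<alpha>"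
proof -
  define J where "J = levy_const \<alpha>"
  have J: "J > 0" using levy_const_pos[OF assms] by (simp add: J_def)
  have int: "integrable lborel (\<lambda>w. indicator {0<..} w *\<^sub>R ((1 - cos (\<xi> * w)) * levy_kernel \<alpha> w))"
  proof (rule Bochner_Integration.integrable_bound)
    show "integrable lborel (\<lambda>w. (2 + \<xi>\<^sup>2) * (indicator {0<..} w *\<^sub>R (min 1 (w\<^sup>2) * levy_kernel \<alpha> w)))"
      using levy_kernel_integrable[OF assms] by (simp add: set_integrable_def)
    have "(1 - cos (\<xi> * w)) * levy_kernel \<alpha> w \<le> (2 + \<xi>\<^sup>2) * (min 1 (w\<^sup>2) * levy_kernel \<alpha> w)" for w
      using mult_right_mono[OF one_minus_cos_le levy_kernel_nonneg[OF assms]] by (simp add: mult_ac)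
    then show "AE w in lborel. norm (indicator {0<..} w *\<^sub>R ((1 - cos (\<xi> * w)) * levy_kernel \<alpha> w))
       \<le> norm ((2 + \<xi>\<^sup>2) * (indicator {0<..} w *\<^sub>R (min 1 (w\<^sup>2) * levy_kernel \<alpha> w)))"
      using levy_kernel_nonneg[OF assms] by (auto simp: indicator_def abs_mult)
  qed measurable
  then show "set_integrable lborel {0<..} (\<lambda>w. (1 - cos (\<xi> * w)) * levy_kernel \<alpha> w)"
    by (simp add: set_integrable_def)
  define f :: "real \<Rightarrow> real \<Rightarrow> real" where
    "f w t = indicator {0<..} w * (1 - cos (\<xi> * w)) * (indicator {0<..} t *\<^sub>R levy_integrand \<alpha> t w)" for w t
  have f_nonneg: "0 \<le> f w t" for w t
    by (simp add: f_def levy_integrand_nonneg)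
  have f_int: "integrable lborel (f w)" for w
    using levy_integrand_integrable[OF assms, of w] unfolding f_def set_integrable_def
    by (cases "w > 0") auto
  have f_w: "(LINT t|lborel. f w t) = J * (indicator {0<..} w *\<^sub>R ((1 - cos (\<xi> * w)) * levy_kernel \<alpha> w))" for w
    using J by (simp add: f_def levy_kernel_def set_lebesgue_integral_def J_def)
  have f_pair: "integrable (lborel \<Otimes>\<^sub>M lborel) (\<lambda>(w, t). f w t)"
  proof (rule lborel_pair.Fubini_integrable)
    show "(\<lambda>(w, t). f w t) \<in> borel_measurable (lborel \<Otimes>\<^sub>M lborel)"
      unfolding f_def by measurable
    show "integrable lborel (\<lambda>w. LINT t|lborel. norm (case (w, t) of (w, t) \<Rightarrow> f w t))"
      using int f_nonneg by (simp add: f_w)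
  qed (simp add: f_int)
  \<comment> \<open>Here exp(-t) (1 - exp(-t \<xi>^2)) is written as (1 - exp(-(1 + \<xi>^2) t)) -
    (1 - exp(-t)), so that each part is integrable against t^(-1-\<alpha>) and has the value from
    \<open>levy_const_scaled\<close>. The part with s = 1 is the origin of the summand 1 in the
    symbol.\<close>
  have f_t: "(LINT w|lborel. f w t) =
      (indicator {0<..} t *\<^sub>R ((1 - exp (- ((1 + \<xi>\<^sup>2) * t))) * t powr (- 1 - \<alpha>)) -
       indicator {0<..} t *\<^sub>R ((1 - exp (- (1 * t))) * t powr (- 1 - \<alpha>))) / 2" for t
  proof (cases "t > 0")
    case True
    have "(LINT w|lborel. f w t) = exp (- t) * t powr (- 1 - \<alpha>) *
        (LINT w:{0<..}|lborel. (1 - cos (\<xi> * w)) * normal_density 0 (sqrt (2 * t)) w)"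
      unfolding set_lebesgue_integral_def integral_mult_right_zero[symmetric]
      using True by (intro Bochner_Integration.integral_cong) (auto simp: f_def levy_integrand_def)
    also have "\<dots> = exp (- t) * t powr (- 1 - \<alpha>) * ((1 - exp (- (t * \<xi>\<^sup>2))) / 2)"
      using True by (subst integral_one_minus_cos_normal_density) auto
    moreover have "exp (- ((1 + \<xi>\<^sup>2) * t)) = exp (- t) * exp (- (t * \<xi>\<^sup>2))"
      by (simp add: algebra_simps flip: exp_add)
    ultimately show ?thesis
      using True by (simp add: algebra_simps)
  qed (simp add: f_def)
  have "J * (LINT w:{0<..}|lborel. (1 - cos (\<xi> * w)) * levy_kernel \<alpha> w) = (LINT w|lborel. LINT t|lborel. f w t)"
    by (simp add: f_w set_lebesgue_integral_def)
  also have "\<dots> = (LINT t|lborel. LINT w|lborel. f w t)"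
    by (rule lborel_pair.Fubini_integral[OF f_pair, symmetric])
  also have "\<dots> = ((1 + \<xi>\<^sup>2) powr \<alpha> * J - 1 powr \<alpha> * J) / 2"
  proof -
    have s: "0 < 1 + \<xi>\<^sup>2" by (simp add: add_pos_nonneg)
    show ?thesis
      unfolding f_t J_def
      using levy_const_scaled[OF assms s] levy_const_scaled[OF assms, of 1]
      unfolding set_integrable_def set_lebesgue_integral_def
      by (simp add: Bochner_Integration.integral_diff)
  qed
  finally have "J * (1 + 2 * (LINT w:{0<..}|lborel. (1 - cos (\<xi> * w)) * levy_kernel \<alpha> w)) = J * (1 + \<xi>\<^sup>2) powr \<alpha>"
    by (simp add: algebra_simps)
  then show "1 + 2 * (LINT w:{0<..}|lborel. (1 - cos (\<xi> * w)) * levy_kernel \<alpha> w) = (1 + \<xi>\<^sup>2) powr \<alpha>"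
    using J by simp
qed

section \<open>Fourier inversion\<close>

lemma integrable_pair_bound:
  fixes F :: "real \<times> real \<Rightarrow> 'a::{banach, second_countable_topology}" and g k :: "real \<Rightarrow> real"
  assumes F: "F \<in> borel_measurable (lborel \<Otimes>\<^sub>M lborel)"
    and g: "integrable lborel g" and k: "integrable lborel k"
    and le: "\<And>x y. norm (F (x, y)) \<le> g x * k y"
  shows "integrable (lborel \<Otimes>\<^sub>M lborel) F"
proof (rule Bochner_Integration.integrable_bound)
  have [measurable]: "g \<in> borel_measurable borel" "k \<in> borel_measurable borel"
    using g k by auto
  show "integrable (lborel \<Otimes>\<^sub>M lborel) (\<lambda>(x, y). g x * k y)"
  proof (rule lborel_pair.Fubini_integrable)
    show "(\<lambda>(x, y). g x * k y) \<in> borel_measurable (lborel \<Otimes>\<^sub>M lborel)"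
      by measurable
    show "integrable lborel (\<lambda>x. LINT y|lborel. norm (case (x, y) of (x, y) \<Rightarrow> g x * k y))"
      using g by (simp add: abs_mult)
  qed (use k in simp)
  have "norm (F (x, y)) \<le> norm (g x * k y)" for x y
    using le[of x y] by (metis abs_ge_self order_trans real_norm_def)
  then show "AE z in lborel \<Otimes>\<^sub>M lborel. norm (F z) \<le> norm (case z of (x, y) \<Rightarrow> g x * k y)"
    by (auto split: prod.splits)
qed (fact F)

lemma integrable_inverse_one_plus_square: "integrable lborel (\<lambda>x::real. 1 / (1 + x\<^sup>2))"
  using integrable_inverse_1_plus_square
  by (simp add: set_integrable_def einterval_def inverse_eq_divide)

section \<open>Fourier transforms of compactly supported functions\<close>

definition supported_in :: "real \<Rightarrow> real \<Rightarrow> (real \<Rightarrow> complex) \<Rightarrow> bool" where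
  "supported_in a b f \<longleftrightarrow> (\<forall>x. x \<notin> {a..b} \<longrightarrow> f x = 0)"

lemma supported_in_vderiv_iter:
  assumes "supported_in a b f"
  shows "supported_in a b (vderiv_iter n f)"
proof (induction n)
  case (Suc n)
  show ?case
    unfolding supported_in_def vderiv_iter_Suc
  proof (intro allI impI)
    fix x assume "x \<notin> {a..b}"
    then have x: "x \<in> - {a..b}" by simp
    have "open (- {a..b})" by (intro open_Compl closed_atLeastAtMost)
    then have "(vderiv_iter n f has_vector_derivative 0) (at x)"
      by (rule has_vector_derivative_transform_within_open[OF has_vector_derivative_const[of 0] _ x])
        (use Suc in \<open>simp add: supported_in_def\<close>)
    then show "vector_derivative (vderiv_iter n f) (at x) = 0"
      by (rule vector_derivative_at)
  qed
qed (use assms in simp)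

lemma supported_in_integrable:
  assumes "continuous_on UNIV f" "supported_in a b f"
  shows "integrable lborel f"
proof -
  have "integrable lborel (\<lambda>x. indicator {a..b} x *\<^sub>R f x)"
    by (intro borel_integrable_compact compact_Icc continuous_on_subset[OF assms(1)]) auto
  also have "(\<lambda>x. indicator {a..b} x *\<^sub>R f x) = f"
    using assms(2) by (force simp: indicator_def supported_in_def)
  finally show ?thesis .
qed

lemma supported_in_bounded:
  assumes "continuous_on UNIV f" "supported_in a b f"
  shows "\<exists>B\<ge>0. \<forall>x. norm (f x) \<le> B"
proof -
  have "compact (f ` {a..b})"
    by (intro compact_continuous_image continuous_on_subset[OF assms(1)]) auto
  then obtain B where B: "\<And>x. x \<in> {a..b} \<Longrightarrow> norm (f x) \<le> B"
    by (meson bounded_iff compact_imp_bounded imageI)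
  have "norm (f x) \<le> \<bar>B\<bar>" for x
    using B[of x] assms(2) by (cases "x \<in> {a..b}") (auto simp: supported_in_def)
  then show ?thesis by (intro exI[of _ "\<bar>B\<bar>"]) auto
qed

text \<open>Integration by parts; the sign is that of the convention exp(i \<xi> x) in the forward
  transform.\<close>

lemma fourier_integral_derivative:
  assumes f': "\<And>x. (f has_vector_derivative f' x) (at x)"
    and cont: "continuous_on UNIV f'"
    and supp: "supported_in a b f" "supported_in a b f'"
  shows "(LINT x|lborel. iexp (\<xi> * x) * f' x) = - \<i> * complex_of_real \<xi> * (LINT x|lborel. iexp (\<xi> * x) * f x)"
proof -
  \<comment> \<open>Nothing is assumed about the order of \<open>a\<close> and \<open>b\<close>,
    hence the minimum and maximum. The margin 1 puts both endpoints outside the support, so the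
    boundary terms vanish.\<close>
  define p q where "p = min a b - 1" and "q = max a b + 1"
  have contf: "continuous_on UNIV f"
    using f' by (meson continuous_at_imp_continuous_on has_vector_derivative_continuous)
  define F' where "F' x = iexp (\<xi> * x) * f' x + \<i> * complex_of_real \<xi> * (iexp (\<xi> * x) * f x)" for x
  have e: "((\<lambda>x. iexp (\<xi> * x)) has_vector_derivative \<i> * complex_of_real \<xi> * iexp (\<xi> * x)) (at x within S)" for x S
  proof -
    have "((\<lambda>z. exp (\<i> * (complex_of_real \<xi> * z))) has_field_derivative
        \<i> * complex_of_real \<xi> * exp (\<i> * (complex_of_real \<xi> * complex_of_real x))) (at (complex_of_real x))"
      by (auto intro!: derivative_eq_intros)
    from has_vector_derivative_real_field[OF this] show ?thesis
      by (simp add: has_vector_derivative_at_within)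
  qed
  have supp_F': "supported_in a b F'"
    using supp by (simp add: supported_in_def F'_def)
  have "(LINT x|lborel. F' x) = (LINT x|lborel. indicator {p..q} x *\<^sub>R F' x)"
    using supp_F' by (intro Bochner_Integration.integral_cong)
      (force simp: supported_in_def indicator_def p_def q_def)+
  also have "\<dots> = iexp (\<xi> * q) * f q - iexp (\<xi> * p) * f p"
  proof (rule integral_FTC_atLeastAtMost)
    show "((\<lambda>x. iexp (\<xi> * x) * f x) has_vector_derivative F' x) (at x within {p..q})" for x
      using has_vector_derivative_mult[OF e[of x "{p..q}"] has_vector_derivative_at_within[OF f']]
      by (simp add: F'_def algebra_simps)
    show "continuous_on {p..q} F'"
      unfolding F'_def by (intro continuous_intros continuous_on_subset[OF contf] continuous_on_subset[OF cont]) auto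
  qed (auto simp: p_def q_def)
  also have "\<dots> = 0"
  proof -
    have "p \<notin> {a..b}" "q \<notin> {a..b}" by (auto simp: p_def q_def)
    then show ?thesis using supp(1) by (simp add: supported_in_def)
  qed
  finally have "0 = (LINT x|lborel. F' x)" ..
  also have "\<dots> = (LINT x|lborel. iexp (\<xi> * x) * f' x) + (LINT x|lborel. \<i> * complex_of_real \<xi> * (iexp (\<xi> * x) * f x))"
    unfolding F'_def
  proof (rule Bochner_Integration.integral_add)
    show "integrable lborel (\<lambda>x. iexp (\<xi> * x) * f' x)"
      by (rule supported_in_integrable[of _ a b])
        (use supp cont in \<open>auto simp: supported_in_def intro!: continuous_intros\<close>)
    show "integrable lborel (\<lambda>x. \<i> * complex_of_real \<xi> * (iexp (\<xi> * x) * f x))"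
      by (rule supported_in_integrable[of _ a b])
        (use supp contf in \<open>auto simp: supported_in_def intro!: continuous_intros\<close>)
  qed
  finally show ?thesis
    by (simp add: eq_neg_iff_add_eq_0)
qed

lemma norm_iexp_integral_le:
  "norm (LINT x|lborel. iexp (\<xi> * x) * f x) \<le> (LINT x|lborel. norm (f x))"
  using integral_norm_bound[of lborel "\<lambda>x. iexp (\<xi> * x) * f x"] by (simp add: norm_mult)

text \<open>Four derivatives give \<xi>^4, and (1 + \<xi>^2)^2 \<le> 2 (1 + \<xi>^4) turns this into
  two powers of 1 + \<xi>^2. One absorbs the growth of 1 - cos in \<xi>, the other provides
  integrability.\<close>

lemma fourier_decay:
  assumes f: "smooth_fun f" "supported_in a b f"
  shows "\<exists>C\<ge>0. \<forall>\<xi>. (1 + \<xi>\<^sup>2) * norm (fourier f \<xi>) \<le> C / (1 + \<xi>\<^sup>2)"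
proof -
  define I where "I n \<xi> = (LINT x|lborel. iexp (\<xi> * x) * vderiv_iter n f x)" for n \<xi>
  define B where "B n = (LINT x|lborel. norm (vderiv_iter n f x))" for n
  have "I (Suc n) \<xi> = - \<i> * complex_of_real \<xi> * I n \<xi>" for n \<xi>
    unfolding I_def
    by (rule fourier_integral_derivative smooth_fun_has_vector_derivative continuous_on_vderiv_iter
        supported_in_vderiv_iter f)+
  then have I4: "I 4 \<xi> = complex_of_real (\<xi> ^ 4) * I 0 \<xi>" for \<xi>
    by (simp add: numeral_eq_Suc) (simp add: algebra_simps)
  have le: "norm (I n \<xi>) \<le> B n" for n \<xi>
    unfolding I_def B_def by (rule norm_iexp_integral_le)
  have B: "B n \<ge> 0" for n
    unfolding B_def by (rule integral_nonneg_AE) simp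
  define c where "c = 1 / sqrt (2 * pi)"
  have "(1 + \<xi>\<^sup>2) * norm (fourier f \<xi>) \<le> (2 * c * (B 0 + B 4)) / (1 + \<xi>\<^sup>2)" for \<xi>
  proof -
    have "norm (fourier f \<xi>) = c * norm (I 0 \<xi>)"
      by (simp add: fourier_def I_def c_def norm_mult norm_divide)
    moreover have "(1 + \<xi>\<^sup>2)\<^sup>2 * (c * norm (I 0 \<xi>)) \<le> 2 * (1 + \<xi> ^ 4) * (c * norm (I 0 \<xi>))"
      using zero_le_power2[of "1 - \<xi>\<^sup>2"]
      by (intro mult_right_mono) (auto simp: c_def power2_sum power2_diff simp flip: power_mult)
    moreover have "2 * c * ((1 + \<xi> ^ 4) * norm (I 0 \<xi>)) \<le> 2 * c * (B 0 + B 4)"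
      using le[of 0 \<xi>] le[of 4 \<xi>]
      by (intro mult_left_mono) (auto simp: I4 norm_mult norm_power distrib_right c_def)
    ultimately have "(1 + \<xi>\<^sup>2)\<^sup>2 * norm (fourier f \<xi>) \<le> 2 * c * (B 0 + B 4)"
      by (simp add: mult_ac)
    moreover have "1 + \<xi>\<^sup>2 > 0" by (simp add: add_pos_nonneg)
    ultimately show ?thesis
      by (simp add: field_simps power2_eq_square)
  qed
  moreover have "2 * c * (B 0 + B 4) \<ge> 0"
    using B by (simp add: c_def)
  ultimately show ?thesis by blast
qed

lemma fourier_measurable:
  assumes "f \<in> borel_measurable borel"
  shows "fourier f \<in> borel_measurable borel"
proof -
  note assms [measurable]
  show ?thesis unfolding fourier_def[abs_def] by measurable
qed

lemma fourier_integrable: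
  assumes f: "smooth_fun f" "supported_in a b f"
  shows "integrable lborel (\<lambda>\<xi>. (1 + \<xi>\<^sup>2) * norm (fourier f \<xi>))" and "integrable lborel (fourier f)"
proof -
  have contf: "continuous_on UNIV f"
    using continuous_on_vderiv_iter[OF f(1), of UNIV 0] by simp
  then have [measurable]: "fourier f \<in> borel_measurable borel"
    by (intro fourier_measurable borel_measurable_continuous_onI)
  obtain C where C: "C \<ge> 0" "\<And>\<xi>. (1 + \<xi>\<^sup>2) * norm (fourier f \<xi>) \<le> C / (1 + \<xi>\<^sup>2)"
    using fourier_decay[OF f] by blast
  show 1: "integrable lborel (\<lambda>\<xi>. (1 + \<xi>\<^sup>2) * norm (fourier f \<xi>))"
  proof (rule Bochner_Integration.integrable_bound)
    show "integrable lborel (\<lambda>\<xi>::real. C * (1 / (1 + \<xi>\<^sup>2)))"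
      by (intro integrable_mult_right integrable_inverse_one_plus_square)
    have "norm ((1 + \<xi>\<^sup>2) * norm (fourier f \<xi>)) \<le> norm (C * (1 / (1 + \<xi>\<^sup>2)))" for \<xi>
      using C(2)[of \<xi>] C(1) by (simp add: abs_mult)
    then show "AE \<xi> in lborel. norm ((1 + \<xi>\<^sup>2) * norm (fourier f \<xi>)) \<le> norm (C * (1 / (1 + \<xi>\<^sup>2)))"
      by simp
  qed measurable
  show "integrable lborel (fourier f)"
  proof (rule Bochner_Integration.integrable_bound[OF 1])
    have "norm (fourier f \<xi>) \<le> norm ((1 + \<xi>\<^sup>2) * norm (fourier f \<xi>))" for \<xi>
      by (simp add: abs_mult distrib_right)
    then show "AE \<xi> in lborel. norm (fourier f \<xi>) \<le> norm ((1 + \<xi>\<^sup>2) * norm (fourier f \<xi>))"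
      by simp
  qed measurable
qed

text \<open>Damping the transform by a Gaussian amounts to averaging \<open>f\<close> against a Gaussian of width \<open>s\<close>;
  letting \<open>s\<close> tend to 0 gives the inversion formula.\<close>

lemma fourier_gauss_mean:
  assumes contf: "continuous_on UNIV f" and f: "integrable lborel f" and "s > 0"
  shows "(LINT \<xi>|lborel. iexp (- (\<xi> * x)) * fourier f \<xi> * complex_of_real (exp (- (s\<^sup>2 * \<xi>\<^sup>2 / 2)))) =
    (LINT z|lborel. f (x + s * z) * complex_of_real (exp (- (z\<^sup>2 / 2))))"
proof -
  have [measurable]: "f \<in> borel_measurable borel"
    using contf by (rule borel_measurable_continuous_onI)
  define G where "G \<xi> = exp (- (s\<^sup>2 * \<xi>\<^sup>2 / 2))" for \<xi>
  define c where "c = sqrt (2 * pi)"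
  have c: "c > 0" by (simp add: c_def)
  \<comment> \<open>The damping is a multiple of the normal density of deviation 1/s. It makes the
    double integral absolutely convergent, and its transform is a Gaussian of width s.\<close>
  have G: "G \<xi> = c / s * normal_density 0 (1 / s) \<xi>" for \<xi>
    using \<open>s > 0\<close> by (simp add: G_def c_def normal_density_def real_sqrt_divide field_simps power_divide)
  have G_int: "integrable lborel G"
    unfolding G[abs_def] using \<open>s > 0\<close> by (intro integrable_mult_right integrable_normal_density) auto
  have [measurable]: "G \<in> borel_measurable borel"
    unfolding G_def by measurable
  define F where "F \<xi> y = complex_of_real (1 / c) * (iexp (- (\<xi> * x)) * (iexp (\<xi> * y) * f y) * complex_of_real (G \<xi>))" for \<xi> y
  have F_int: "integrable (lborel \<Otimes>\<^sub>M lborel) (\<lambda>(\<xi>, y). F \<xi> y)"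
  proof (rule integrable_pair_bound)
    show "integrable lborel (\<lambda>\<xi>. 1 / c * G \<xi>)" "integrable lborel (\<lambda>y. norm (f y))"
      using G_int f by auto
    show "norm (case (\<xi>, y) of (\<xi>, y) \<Rightarrow> F \<xi> y) \<le> 1 / c * G \<xi> * norm (f y)" for \<xi> y
      using c by (simp add: F_def norm_mult G_def norm_divide mult.commute)
    show "(\<lambda>(\<xi>, y). F \<xi> y) \<in> borel_measurable (lborel \<Otimes>\<^sub>M lborel)"
      unfolding F_def by measurable
  qed
  have "(LINT \<xi>|lborel. iexp (- (\<xi> * x)) * fourier f \<xi> * complex_of_real (G \<xi>)) = (LINT \<xi>|lborel. LINT y|lborel. F \<xi> y)"
  proof (intro Bochner_Integration.integral_cong refl)
    fix \<xi>
    have "F \<xi> y = complex_of_real (1 / c) * iexp (- (\<xi> * x)) * complex_of_real (G \<xi>) * (iexp (\<xi> * y) * f y)" for y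
      by (simp add: F_def)
    then have "(LINT y|lborel. F \<xi> y) =
        complex_of_real (1 / c) * iexp (- (\<xi> * x)) * complex_of_real (G \<xi>) * (LINT y|lborel. iexp (\<xi> * y) * f y)"
      by (simp only: integral_mult_right_zero)
    then show "iexp (- (\<xi> * x)) * fourier f \<xi> * complex_of_real (G \<xi>) = (LINT y|lborel. F \<xi> y)"
      by (simp add: fourier_def c_def)
  qed
  also have "\<dots> = (LINT y|lborel. LINT \<xi>|lborel. F \<xi> y)"
    by (rule lborel_pair.Fubini_integral[OF F_int, symmetric])
  also have "\<dots> = (LINT y|lborel. f y * complex_of_real (1 / s * exp (- ((y - x)\<^sup>2 / (2 * s\<^sup>2)))))"
  proof (intro Bochner_Integration.integral_cong refl)
    fix y
    have "iexp (- (\<xi> * x)) * iexp (\<xi> * y) = iexp ((y - x) * \<xi>)" for \<xi>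
      by (simp add: algebra_simps flip: exp_add)
    then have "F \<xi> y = f y * complex_of_real (1 / s) * (iexp ((y - x) * \<xi>) * complex_of_real (normal_density 0 (1 / s) \<xi>))" for \<xi>
      using c by (simp add: F_def G mult_ac)
    then have "(LINT \<xi>|lborel. F \<xi> y) = f y * complex_of_real (1 / s) *
       (LINT \<xi>|lborel. iexp ((y - x) * \<xi>) * complex_of_real (normal_density 0 (1 / s) \<xi>))"
      by simp
    also have "\<dots> = f y * complex_of_real (1 / s * exp (- ((y - x)\<^sup>2 / (2 * s\<^sup>2))))"
      using \<open>s > 0\<close> by (subst integral_iexp_normal_density(2)) (auto simp: field_simps)
    finally show "(LINT \<xi>|lborel. F \<xi> y) = f y * complex_of_real (1 / s * exp (- ((y - x)\<^sup>2 / (2 * s\<^sup>2))))" .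
  qed
  also have "\<dots> = (LINT z|lborel. f (x + s * z) * complex_of_real (exp (- (z\<^sup>2 / 2))))"
    by (subst lborel_integral_real_affine[of s _ x])
      (use \<open>s > 0\<close> in \<open>auto simp: power_mult_distrib scaleR_conv_of_real\<close>)
  finally show ?thesis unfolding G_def .
qed

text \<open>Both sides are limits of the same damped integrals along s = 1/(n + 1). The frequency
  side is dominated by the norm of the transform, the space side by \<open>B\<close> times a
  Gaussian.\<close>

lemma fourier_inversion:
  assumes contf: "continuous_on UNIV f" and f: "integrable lborel f" and B: "\<And>x. norm (f x) \<le> B"
    and hat: "integrable lborel (fourier f)"
  shows "(LINT \<xi>|lborel. iexp (- (\<xi> * x)) * fourier f \<xi>) = complex_of_real (sqrt (2 * pi)) * f x"
proof (rule LIMSEQ_unique)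
  have [measurable]: "f \<in> borel_measurable borel"
    using contf by (rule borel_measurable_continuous_onI)
  have [measurable]: "fourier f \<in> borel_measurable borel"
    using hat by auto
  define s where "s n = 1 / real (Suc n)" for n
  have s: "s \<longlonglongrightarrow> 0" "s n > 0" for n
    unfolding s_def using LIMSEQ_Suc[OF lim_1_over_n] by auto
  show "(\<lambda>n. LINT \<xi>|lborel. iexp (- (\<xi> * x)) * fourier f \<xi> * complex_of_real (exp (- ((s n)\<^sup>2 * \<xi>\<^sup>2 / 2))))
      \<longlonglongrightarrow> (LINT \<xi>|lborel. iexp (- (\<xi> * x)) * fourier f \<xi>)"
  proof (rule integral_dominated_convergence)
    show "integrable lborel (\<lambda>\<xi>. norm (fourier f \<xi>))" using hat by simp
    have "(\<lambda>n. iexp (- (\<xi> * x)) * fourier f \<xi> * complex_of_real (exp (- ((s n)\<^sup>2 * \<xi>\<^sup>2 / 2))))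
        \<longlonglongrightarrow> iexp (- (\<xi> * x)) * fourier f \<xi> * complex_of_real (exp (- (0\<^sup>2 * \<xi>\<^sup>2 / 2)))" for \<xi>
      by (intro tendsto_intros s) simp
    then show "AE \<xi> in lborel. (\<lambda>n. iexp (- (\<xi> * x)) * fourier f \<xi> * complex_of_real (exp (- ((s n)\<^sup>2 * \<xi>\<^sup>2 / 2))))
        \<longlonglongrightarrow> iexp (- (\<xi> * x)) * fourier f \<xi>"
      by simp
    show "AE \<xi> in lborel. norm (iexp (- (\<xi> * x)) * fourier f \<xi> * complex_of_real (exp (- ((s n)\<^sup>2 * \<xi>\<^sup>2 / 2)))) \<le> norm (fourier f \<xi>)" for n
      by (auto simp: norm_mult intro!: mult_right_le_one_le)
  qed measurable
  have "(\<lambda>n. LINT z|lborel. f (x + s n * z) * complex_of_real (exp (- (z\<^sup>2 / 2))))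
      \<longlonglongrightarrow> (LINT z|lborel. f x * complex_of_real (exp (- (z\<^sup>2 / 2))))"
  proof (rule integral_dominated_convergence)
    have gauss: "(\<lambda>z. exp (- (z\<^sup>2 / 2))) = (\<lambda>z. sqrt (2 * pi) * normal_density 0 1 z)"
      by (simp add: normal_density_def)
    have "integrable lborel (\<lambda>z::real. exp (- (z\<^sup>2 / 2)))"
      unfolding gauss by (intro integrable_mult_right integrable_normal_density) auto
    then show "integrable lborel (\<lambda>z::real. B * exp (- (z\<^sup>2 / 2)))"
      by (rule integrable_mult_right)
    show "AE z in lborel. (\<lambda>n. f (x + s n * z) * complex_of_real (exp (- (z\<^sup>2 / 2))))
        \<longlonglongrightarrow> f x * complex_of_real (exp (- (z\<^sup>2 / 2)))"
    proof (intro AE_I2 tendsto_mult tendsto_const)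
      fix z
      have "(\<lambda>n. x + s n * z) \<longlonglongrightarrow> x + 0 * z"
        by (intro tendsto_intros s)
      then show "(\<lambda>n. f (x + s n * z)) \<longlonglongrightarrow> f x"
        using contf by (intro continuous_on_tendsto_compose[OF contf]) auto
    qed
    show "AE z in lborel. norm (f (x + s n * z) * complex_of_real (exp (- (z\<^sup>2 / 2)))) \<le> B * exp (- (z\<^sup>2 / 2))" for n
      using B by (auto simp: norm_mult)
  qed measurable
  also have "(LINT z|lborel. f x * complex_of_real (exp (- (z\<^sup>2 / 2)))) = f x * complex_of_real (sqrt (2 * pi))"
  proof -
    have gauss: "(\<lambda>z. exp (- (z\<^sup>2 / 2))) = (\<lambda>z. sqrt (2 * pi) * normal_density 0 1 z)"
      by (simp add: normal_density_def)
    have "(LINT z|lborel. exp (- (z\<^sup>2 / 2))) = sqrt (2 * pi)"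
      unfolding gauss by simp
    then show ?thesis by simp
  qed
  finally show "(\<lambda>n. LINT \<xi>|lborel. iexp (- (\<xi> * x)) * fourier f \<xi> * complex_of_real (exp (- ((s n)\<^sup>2 * \<xi>\<^sup>2 / 2))))
      \<longlonglongrightarrow> complex_of_real (sqrt (2 * pi)) * f x"
    unfolding fourier_gauss_mean[OF contf f s(2)] by (simp add: mult.commute)
qed

text \<open>The multiplier minus 1 is the w-integral of 2 (1 - cos(\<xi> w)) m(w), and 2 (1 -
  cos(\<xi> w)) exp(-i \<xi> x) is the second difference of exp(-i \<xi> x) in x with step w. After
  Fubini, inversion is applied at x, x + w and x - w.\<close>

lemma Aop_eq_second_difference:
  assumes \<alpha>: "0 < \<alpha>" "\<alpha> < 1" and f: "smooth_fun f" "supported_in a b f"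
  shows "Aop \<alpha> f x = f x +
    (LINT w:{0<..}|lborel. (2 * f x - f (x + w) - f (x - w)) * complex_of_real (levy_kernel \<alpha> w))"
proof -
  define m where "m = levy_kernel \<alpha>"
  define g where "g = fourier f"
  define c where "c = sqrt (2 * pi)"
  have c: "c > 0" by (simp add: c_def)
  have contf: "continuous_on UNIV f"
    using continuous_on_vderiv_iter[OF f(1), of UNIV 0] by simp
  have g_int: "integrable lborel (\<lambda>\<xi>. (1 + \<xi>\<^sup>2) * norm (g \<xi>))" "integrable lborel g"
    using fourier_integrable[OF f] by (auto simp: g_def)
  obtain B where B: "\<And>x. norm (f x) \<le> B"
    using supported_in_bounded[OF contf f(2)] by blast
  have inv: "(LINT \<xi>|lborel. iexp (- (\<xi> * x)) * g \<xi>) = complex_of_real c * f x" for x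
    unfolding g_def c_def
    by (intro fourier_inversion[OF contf supported_in_integrable[OF contf f(2)] B] g_int(2)[unfolded g_def])
  have [measurable]: "g \<in> borel_measurable borel" "m \<in> borel_measurable borel"
    using g_int by (auto simp: m_def)
  have ig_int: "integrable lborel (\<lambda>\<xi>. iexp (- (\<xi> * x)) * g \<xi>)" for x
    by (rule Bochner_Integration.integrable_bound[OF g_int(2)]) (auto simp: norm_mult)
  define F where "F \<xi> w = indicator {0<..} w *\<^sub>R
      (complex_of_real (2 * ((1 - cos (\<xi> * w)) * m w)) * (iexp (- (\<xi> * x)) * g \<xi>))" for \<xi> w
  have F_int: "integrable (lborel \<Otimes>\<^sub>M lborel) (\<lambda>(\<xi>, w). F \<xi> w)"
  proof (rule integrable_pair_bound)
    show "(\<lambda>(\<xi>, w). F \<xi> w) \<in> borel_measurable (lborel \<Otimes>\<^sub>M lborel)"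
      unfolding F_def by measurable
    \<comment> \<open>The majorant comes from \<open>one_minus_cos_le\<close> through 2 (2 +
      \<xi>^2) \<le> 4 (1 + \<xi>^2); this is why the transform must be integrable against 1 +
      \<xi>^2.\<close>
    show "integrable lborel (\<lambda>\<xi>. 4 * ((1 + \<xi>\<^sup>2) * norm (g \<xi>)))"
      using g_int(1) by simp
    show "integrable lborel (\<lambda>w. indicator {0<..} w *\<^sub>R (min 1 (w\<^sup>2) * m w))"
      using levy_kernel_integrable[OF \<alpha>] by (simp add: set_integrable_def m_def)
    fix \<xi> w :: real
    have m: "0 \<le> m w" using levy_kernel_nonneg[OF \<alpha>] by (simp add: m_def)
    have "2 * (1 - cos (\<xi> * w)) * (m w * norm (g \<xi>)) \<le> 2 * ((2 + \<xi>\<^sup>2) * min 1 (w\<^sup>2)) * (m w * norm (g \<xi>))"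
      using one_minus_cos_le[of \<xi> w] m by (intro mult_right_mono) auto
    also have "\<dots> \<le> 4 * ((1 + \<xi>\<^sup>2) * min 1 (w\<^sup>2)) * (m w * norm (g \<xi>))"
    proof -
      have "2 * ((2 + \<xi>\<^sup>2) * min 1 (w\<^sup>2)) \<le> 4 * ((1 + \<xi>\<^sup>2) * min 1 (w\<^sup>2))"
        by (simp add: distrib_right mult_nonneg_nonneg)
      then show ?thesis using m by (intro mult_right_mono) auto
    qed
    finally have le: "2 * (1 - cos (\<xi> * w)) * (m w * norm (g \<xi>)) \<le>
      4 * ((1 + \<xi>\<^sup>2) * min 1 (w\<^sup>2)) * (m w * norm (g \<xi>))" .
    have "norm (F \<xi> w) = indicator {0<..} w * (2 * (1 - cos (\<xi> * w)) * (m w * norm (g \<xi>)))"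
      unfolding F_def norm_scaleR norm_mult norm_of_real using m by (simp add: abs_mult)
    also have "\<dots> \<le> indicator {0<..} w * (4 * ((1 + \<xi>\<^sup>2) * min 1 (w\<^sup>2)) * (m w * norm (g \<xi>)))"
      by (intro mult_left_mono le) simp
    also have "\<dots> = 4 * ((1 + \<xi>\<^sup>2) * norm (g \<xi>)) * (indicator {0<..} w *\<^sub>R (min 1 (w\<^sup>2) * m w))"
      by simp
    finally show "norm (case (\<xi>, w) of (\<xi>, w) \<Rightarrow> F \<xi> w) \<le>
        4 * ((1 + \<xi>\<^sup>2) * norm (g \<xi>)) * (indicator {0<..} w *\<^sub>R (min 1 (w\<^sup>2) * m w))"
      by simp
  qed
  have F_w: "(LINT w|lborel. F \<xi> w) = complex_of_real ((1 + \<xi>\<^sup>2) powr \<alpha> - 1) * (iexp (- (\<xi> * x)) * g \<xi>)" for \<xi>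
  proof -
    have "F \<xi> w = complex_of_real (2 * (indicator {0<..} w *\<^sub>R ((1 - cos (\<xi> * w)) * m w))) * (iexp (- (\<xi> * x)) * g \<xi>)" for w
      by (simp add: F_def indicator_def)
    then have "(LINT w|lborel. F \<xi> w) =
        complex_of_real (2 * (LINT w:{0<..}|lborel. (1 - cos (\<xi> * w)) * m w)) * (iexp (- (\<xi> * x)) * g \<xi>)"
      by (simp only: integral_mult_left_zero integral_mult_right_zero integral_complex_of_real set_lebesgue_integral_def)
    also have "2 * (LINT w:{0<..}|lborel. (1 - cos (\<xi> * w)) * m w) = (1 + \<xi>\<^sup>2) powr \<alpha> - 1"
      using levy_symbol(2)[OF \<alpha>, of \<xi>] by (simp add: m_def)
    finally show ?thesis .
  qed
  have F_\<xi>: "(LINT \<xi>|lborel. F \<xi> w) =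
      indicator {0<..} w *\<^sub>R (complex_of_real c * ((2 * f x - f (x + w) - f (x - w)) * complex_of_real (m w)))" for w
  proof -
    have "complex_of_real (2 * (1 - cos (\<xi> * w))) * iexp (- (\<xi> * x)) =
        2 * iexp (- (\<xi> * x)) - iexp (- (\<xi> * (x + w))) - iexp (- (\<xi> * (x - w)))" for \<xi>
    proof -
      have e: "iexp (- (\<xi> * (x + w))) = iexp (- (\<xi> * x)) * iexp (- (\<xi> * w))"
        "iexp (- (\<xi> * (x - w))) = iexp (- (\<xi> * x)) * iexp (\<xi> * w)"
        by (simp_all add: algebra_simps flip: exp_add)
      have "complex_of_real (2 * (1 - cos (\<xi> * w))) = 2 - (iexp (- (\<xi> * w)) + iexp (\<xi> * w))"
        by (simp add: complex_eq_iff Re_exp Im_exp)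
      then have "complex_of_real (2 * (1 - cos (\<xi> * w))) * iexp (- (\<xi> * x)) =
          (2 - (iexp (- (\<xi> * w)) + iexp (\<xi> * w))) * iexp (- (\<xi> * x))"
        by (rule arg_cong)
      also have "\<dots> = 2 * iexp (- (\<xi> * x)) - iexp (- (\<xi> * (x + w))) - iexp (- (\<xi> * (x - w)))"
        unfolding e by (simp only: left_diff_distrib distrib_right right_diff_distrib distrib_left mult.commute diff_diff_add)
      finally show ?thesis .
    qed
    then have "F \<xi> w = (indicator {0<..} w *\<^sub>R complex_of_real (m w)) *
        (2 * (iexp (- (\<xi> * x)) * g \<xi>) - iexp (- (\<xi> * (x + w))) * g \<xi> - iexp (- (\<xi> * (x - w))) * g \<xi>)" for \<xi>
      unfolding F_def by (simp add: left_diff_distrib[symmetric] mult.assoc[symmetric] del: of_real_diff of_real_mult mult_minus_right)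
        (simp add: mult_ac)
    then have "(LINT \<xi>|lborel. F \<xi> w) = (indicator {0<..} w *\<^sub>R complex_of_real (m w)) *
        (2 * (LINT \<xi>|lborel. iexp (- (\<xi> * x)) * g \<xi>) - (LINT \<xi>|lborel. iexp (- (\<xi> * (x + w))) * g \<xi>) -
          (LINT \<xi>|lborel. iexp (- (\<xi> * (x - w))) * g \<xi>))"
      using ig_int by (simp del: of_real_mult of_real_minus of_real_add of_real_diff)
    then show ?thesis
      unfolding inv by (simp add: algebra_simps)
  qed
  have "Aop \<alpha> f x = complex_of_real (1 / c) *
      (LINT \<xi>|lborel. iexp (- (\<xi> * x)) * g \<xi> + (LINT w|lborel. F \<xi> w))"
    unfolding Aop_def fourier_inv_def F_w g_def c_def
    by (simp add: algebra_simps)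
  also have "(LINT \<xi>|lborel. iexp (- (\<xi> * x)) * g \<xi> + (LINT w|lborel. F \<xi> w)) =
      complex_of_real c * f x + (LINT \<xi>|lborel. LINT w|lborel. F \<xi> w)"
    using Bochner_Integration.integral_add[OF ig_int[of x] lborel_pair.integrable_fst'[OF F_int]]
    by (simp only: inv prod.case)
  also have "(LINT \<xi>|lborel. LINT w|lborel. F \<xi> w) = (LINT w|lborel. LINT \<xi>|lborel. F \<xi> w)"
    by (rule lborel_pair.Fubini_integral[OF F_int, symmetric])
  also have "\<dots> = complex_of_real c *
      (LINT w:{0<..}|lborel. (2 * f x - f (x + w) - f (x - w)) * complex_of_real (m w))"
    unfolding F_\<xi> set_lebesgue_integral_def by (simp flip: integral_mult_right_zero)
  finally show ?thesis
    using c by (simp add: m_def distrib_left mult.assoc[symmetric])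
qed

section \<open>Difference estimates for smooth functions\<close>

lemma vector_derivative_bound:
  fixes f :: "real \<Rightarrow> complex"
  assumes f': "\<And>x. (f has_vector_derivative f' x) (at x)"
    and B: "\<And>x. x \<in> closed_segment a b \<Longrightarrow> norm (f' x) \<le> B"
  shows "norm (f b - f a) \<le> B * \<bar>b - a\<bar>"
proof -
  have "norm (f b - f a) \<le> B * norm (b - a)"
  proof (rule differentiable_bound[where S = "closed_segment a b" and f' = "\<lambda>x h. h *\<^sub>R f' x"])
    show "(f has_derivative (\<lambda>h. h *\<^sub>R f' x)) (at x within closed_segment a b)" for x
      using f'[of x] unfolding has_vector_derivative_def by (rule has_derivative_at_withinI)
    show "onorm (\<lambda>h. h *\<^sub>R f' x) \<le> B" if "x \<in> closed_segment a b" for x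
      using B[OF that] by (intro onorm_le) (auto simp: mult.commute[of B] intro!: mult_left_mono)
  qed auto
  then show ?thesis by simp
qed

text \<open>The linear terms at x + w and x - w cancel. Each remainder is at most B w^2, as |h|
  times the oscillation of f'; the triangle inequality gives 4 B for large w.\<close>

lemma second_difference_le:
  fixes f :: "real \<Rightarrow> complex"
  assumes f': "\<And>x. (f has_vector_derivative f' x) (at x)" "\<And>x. (f' has_vector_derivative f'' x) (at x)"
    and B: "\<And>x. norm (f x) \<le> B" "\<And>x. norm (f'' x) \<le> B"
  shows "norm (2 * f x - f (x + w) - f (x - w)) \<le> 4 * B * min 1 (w\<^sup>2)"
proof -
  have lin: "norm (f (x + h) - f x - h *\<^sub>R f' x) \<le> B * h\<^sup>2" for h
  proof -
    have "norm (f (x + h) - f x - (x + h - x) *\<^sub>R f' x) \<le> norm (x + h - x) * (B * \<bar>h\<bar>)"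
    proof (rule vector_differentiable_bound_linearization[where S = "closed_segment x (x + h)"])
      show "norm (f' y - f' x) \<le> B * \<bar>h\<bar>" if "y \<in> closed_segment x (x + h)" for y
      proof -
        have "norm (f' y - f' x) \<le> B * \<bar>y - x\<bar>"
          by (rule vector_derivative_bound[OF f'(2)]) (use B in auto)
        also have "\<dots> \<le> B * \<bar>h\<bar>"
          using that order_trans[OF norm_ge_zero B(1)]
          by (intro mult_left_mono) (auto simp: closed_segment_eq_real_ivl split: if_splits)
        finally show ?thesis .
      qed
    qed (auto intro: has_vector_derivative_at_within f')
    then show ?thesis by (simp add: power2_eq_square mult_ac)
  qed
  have "2 * f x - f (x + w) - f (x - w) =
      - (f (x + w) - f x - w *\<^sub>R f' x) - (f (x + (- w)) - f x - (- w) *\<^sub>R f' x)"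
    by simp
  also have "norm \<dots> \<le> norm (f (x + w) - f x - w *\<^sub>R f' x) + norm (f (x + (- w)) - f x - (- w) *\<^sub>R f' x)"
    using norm_triangle_ineq4[of "- (f (x + w) - f x - w *\<^sub>R f' x)"] by (simp only: norm_minus_cancel)
  also have "\<dots> \<le> 2 * B * w\<^sup>2"
    using lin[of w] lin[of "- w"] by simp
  finally have 1: "norm (2 * f x - f (x + w) - f (x - w)) \<le> 2 * B * w\<^sup>2" .
  have "norm (2 * f x - f (x + w) - f (x - w)) \<le> norm (2 * f x) + norm (f (x + w)) + norm (f (x - w))"
    by norm
  also have "\<dots> \<le> 4 * B"
    using B(1)[of x] B(1)[of "x + w"] B(1)[of "x - w"] by (simp add: norm_mult)
  finally have 2: "norm (2 * f x - f (x + w) - f (x - w)) \<le> 4 * B" .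
  have "0 \<le> B * w\<^sup>2"
    using order_trans[OF norm_ge_zero B(1)] by simp
  with 1 2 show ?thesis by (simp add: min_def)
qed

text \<open>These are the quantitative facts passed on: decay of v gives integrability, decay of v'
  controls forward differences, and the bound on v'' controls second differences. A single constant
  serves all three.\<close>

lemma schwartz_bounds:
  assumes "schwartz v"
  shows "\<exists>K\<ge>0. (\<forall>x. norm (v x) \<le> K / (1 + x\<^sup>2)) \<and> (\<forall>x. norm (vderiv_iter 1 v x) \<le> K / (1 + x\<^sup>2)) \<and>
    (\<forall>x. norm (vderiv_iter 2 v x) \<le> K)"
proof -
  have ex: "\<exists>C\<ge>0. \<forall>x. norm (vderiv_iter n v x) \<le> C / (1 + x\<^sup>2)" for n
  proof -
    obtain C0 C2 where C: "\<And>x. \<bar>x\<bar> ^ 0 * norm (vderiv_iter n v x) \<le> C0"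
      "\<And>x. \<bar>x\<bar> ^ 2 * norm (vderiv_iter n v x) \<le> C2"
      using assms unfolding schwartz_def by meson
    have le: "(1 + x\<^sup>2) * norm (vderiv_iter n v x) \<le> C0 + C2" for x
      using C[of x] by (simp add: distrib_right)
    have "0 \<le> C0 + C2"
      using le[of 0] by (metis norm_ge_zero add_0_right mult_1 order_trans power_zero_numeral)
    moreover have "norm (vderiv_iter n v x) \<le> (C0 + C2) / (1 + x\<^sup>2)" for x
      using le[of x] by (simp add: pos_le_divide_eq add_pos_nonneg mult.commute)
    ultimately show ?thesis by blast
  qed
  obtain C0 C1 C2 where C: "C0 \<ge> 0" "C1 \<ge> 0" "C2 \<ge> 0" "\<And>x. norm (vderiv_iter 0 v x) \<le> C0 / (1 + x\<^sup>2)"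
    "\<And>x. norm (vderiv_iter 1 v x) \<le> C1 / (1 + x\<^sup>2)" "\<And>x. norm (vderiv_iter 2 v x) \<le> C2 / (1 + x\<^sup>2)"
    using ex[of 0] ex[of 1] ex[of 2] by metis
  define K where "K = C0 + C1 + C2"
  have p: "1 + x\<^sup>2 \<ge> 1" for x :: real by simp
  have "C0 / (1 + x\<^sup>2) \<le> K / (1 + x\<^sup>2)" "C1 / (1 + x\<^sup>2) \<le> K / (1 + x\<^sup>2)" for x
    using C p[of x] by (auto intro!: divide_right_mono simp: K_def)
  moreover have "C2 / (1 + x\<^sup>2) \<le> K" for x
    using C(1-3) p[of x] frac_le[of K C2 1 "1 + x\<^sup>2"] by (simp add: K_def)
  moreover have "K \<ge> 0" using C by (simp add: K_def)
  ultimately show ?thesis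
    using C(4-6) by (intro exI[of _ K]) (metis order_trans vderiv_iter_0)
qed

section \<open>The density of the operator on the half-line\<close>

locale schwartz_half_line =
  fixes \<alpha> :: real and v :: "real \<Rightarrow> complex" and K :: real
  assumes \<alpha>: "0 < \<alpha>" "\<alpha> < 1"
    and smooth: "smooth_fun v"
    and K: "0 \<le> K"
    and v_le: "\<And>x. norm (v x) \<le> K / (1 + x\<^sup>2)"
    and v'_le: "\<And>x. norm (vderiv_iter 1 v x) \<le> K / (1 + x\<^sup>2)"
    and v''_le: "\<And>x. norm (vderiv_iter 2 v x) \<le> K"
begin

abbreviation m :: "real \<Rightarrow> real" where "m \<equiv> levy_kernel \<alpha>"

definition trunc_weight :: "real \<Rightarrow> real" where
  "trunc_weight w = indicator {0<..} w * (min 1 (w\<^sup>2) * m w)"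

text \<open>Pairing \<open>y + w\<close> with its mirror image \<open>y - w\<close> as long as the latter stays in the half-line
  makes the principal value an absolutely convergent integral.\<close>

definition sym_diff_Rplus :: "real \<Rightarrow> real \<Rightarrow> complex" where
  "sym_diff_Rplus y w = v y - v (y + w) + (if w < y then v y - v (y - w) else 0)"

definition Acal_density :: "real \<Rightarrow> complex" where
  "Acal_density y = v y + (LINT w:{0<..}|lborel. sym_diff_Rplus y w * complex_of_real (m w))"

lemma m_nonneg: "0 \<le> m w"
  by (rule levy_kernel_nonneg[OF \<alpha>])

lemma trunc_weight_integrable: "integrable lborel trunc_weight"
  using levy_kernel_integrable[OF \<alpha>] by (simp add: set_integrable_def trunc_weight_def[abs_def])

lemma trunc_weight_nonneg: "0 \<le> trunc_weight w"
  by (simp add: trunc_weight_def m_nonneg)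

lemma trunc_weight_measurable [measurable]: "trunc_weight \<in> borel_measurable borel"
  unfolding trunc_weight_def[abs_def] by measurable

lemma continuous_v: "continuous_on S v"
  using continuous_on_vderiv_iter[OF smooth, of S 0] by simp

lemma v_measurable [measurable]: "v \<in> borel_measurable borel"
  by (intro borel_measurable_continuous_onI continuous_v)

lemma v_le_K: "norm (v x) \<le> K"
proof -
  have "K / (1 + x\<^sup>2) \<le> K / 1"
    using K by (intro divide_left_mono) (auto simp: add_pos_nonneg)
  then show ?thesis using v_le[of x] by simp
qed

lemma v_integrable: "integrable lborel v"
proof (rule Bochner_Integration.integrable_bound)
  show "integrable lborel (\<lambda>x::real. K * (1 / (1 + x\<^sup>2)))"
    by (intro integrable_mult_right integrable_inverse_one_plus_square)
  have "norm (v x) \<le> norm (K * (1 / (1 + x\<^sup>2)))" for x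
    using v_le[of x] K by simp
  then show "AE x in lborel. norm (v x) \<le> norm (K * (1 / (1 + x\<^sup>2)))"
    by simp
qed measurable

lemma v_deriv: "(v has_vector_derivative vderiv_iter 1 v x) (at x)"
  "(vderiv_iter 1 v has_vector_derivative vderiv_iter 2 v x) (at x)"
  using smooth_fun_has_vector_derivative[OF smooth, of 0 x] smooth_fun_has_vector_derivative[OF smooth, of 1 x]
  by (simp_all add: numeral_2_eq_2)

lemma sym_diff_Rplus_measurable [measurable]:
  "(\<lambda>(y, w). sym_diff_Rplus y w) \<in> borel_measurable (borel \<Otimes>\<^sub>M borel)"
  unfolding sym_diff_Rplus_def by measurable

lemma sym_diff_Rplus_measurable_snd [measurable]: "sym_diff_Rplus y \<in> borel_measurable borel"
  unfolding sym_diff_Rplus_def[abs_def] by measurable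

text \<open>Forward steps in the half-line move away from the origin, so the bounds for v and v' at
  \<open>y\<close> hold on the whole segment and the decay in \<open>y\<close> survives.\<close>

lemma diff_le:
  assumes "0 < y" "0 < w"
  shows "norm (v y - v (y + w)) \<le> 2 * K / (1 + y\<^sup>2) * min 1 w"
proof -
  have mono: "K / (1 + x\<^sup>2) \<le> K / (1 + y\<^sup>2)" if "x \<ge> y" for x
    using that \<open>0 < y\<close> K by (intro divide_left_mono add_left_mono power_mono mult_pos_pos) (auto simp: add_pos_nonneg)
  have "norm (v (y + w) - v y) \<le> K / (1 + y\<^sup>2) * \<bar>y + w - y\<bar>"
  proof (rule vector_derivative_bound[OF v_deriv(1)])
    show "norm (vderiv_iter 1 v x) \<le> K / (1 + y\<^sup>2)" if "x \<in> closed_segment y (y + w)" for x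
      using that assms mono[of x] v'_le[of x] by (auto simp: closed_segment_eq_real_ivl)
  qed
  then have 1: "norm (v y - v (y + w)) \<le> K / (1 + y\<^sup>2) * w"
    using assms by (simp add: norm_minus_commute)
  have "norm (v y - v (y + w)) \<le> norm (v y) + norm (v (y + w))"
    by (rule norm_triangle_ineq4)
  also have "\<dots> \<le> 2 * (K / (1 + y\<^sup>2))"
    using v_le[of y] v_le[of "y + w"] mono[of "y + w"] assms by simp
  finally have 2: "norm (v y - v (y + w)) \<le> 2 * (K / (1 + y\<^sup>2))" .
  have "0 \<le> K / (1 + y\<^sup>2) * w"
    using K assms by (intro mult_nonneg_nonneg divide_nonneg_nonneg) auto
  with 1 2 show ?thesis by (simp add: min_def)
qed

lemma sym_diff_Rplus_le_near:
  assumes "w < y"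
  shows "norm (sym_diff_Rplus y w) \<le> 4 * K * min 1 (w\<^sup>2)"
  using second_difference_le[OF v_deriv v_le_K v''_le, of y w] assms
  by (simp add: sym_diff_Rplus_def algebra_simps)

text \<open>The mirror term is cut off here and the linear part does not cancel, so only first order
  in w remains.\<close>

lemma sym_diff_Rplus_le_far:
  assumes "0 < y" "y \<le> w"
  shows "norm (sym_diff_Rplus y w) \<le> 2 * K * min 1 w"
proof -
  have "norm (sym_diff_Rplus y w) \<le> 2 * K / (1 + y\<^sup>2) * min 1 w"
    using diff_le[of y w] assms by (simp add: sym_diff_Rplus_def)
  also have "\<dots> \<le> 2 * K / 1 * min 1 w"
    using K assms by (intro mult_right_mono divide_left_mono) (auto simp: add_pos_nonneg)
  finally show ?thesis by simp
qed

text \<open>Away from the boundary the far case has w \<ge> a, where min(1, w^2) is bounded below;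
  second order is recovered at the price of a constant that blows up as \<open>a\<close> tends to
  0.\<close>

lemma sym_diff_Rplus_le:
  assumes "0 < a" "a \<le> y" "0 < w"
  shows "norm (sym_diff_Rplus y w) \<le> 4 * K / min 1 (a\<^sup>2) * min 1 (w\<^sup>2)"
proof -
  have a: "0 < min 1 (a\<^sup>2)" using assms by simp
  show ?thesis
  proof (cases "w < y")
    case True
    have "4 * K * min 1 (w\<^sup>2) \<le> 4 * K / min 1 (a\<^sup>2) * min 1 (w\<^sup>2)"
      using K a by (intro mult_right_mono) (auto simp: pos_le_divide_eq mult_left_le)
    with sym_diff_Rplus_le_near[OF True] show ?thesis by linarith
  next
    case False
    then have "a\<^sup>2 \<le> w\<^sup>2" using assms by (intro power_mono) auto
    then have "1 \<le> 1 / min 1 (a\<^sup>2) * min 1 (w\<^sup>2)"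
      using a by (simp add: pos_le_divide_eq)
    then have "4 * K * 1 \<le> 4 * K * (1 / min 1 (a\<^sup>2) * min 1 (w\<^sup>2))"
      using K by (intro mult_left_mono) auto
    moreover have "2 * K * min 1 w \<le> 2 * K * 1"
      using K by (intro mult_left_mono) auto
    ultimately show ?thesis
      using sym_diff_Rplus_le_far[of y w] False assms K by simp
  qed
qed

lemma norm_sym_diff_weighted_le:
  assumes "0 < a" "a \<le> y"
  shows "norm (indicator {0<..} w *\<^sub>R (sym_diff_Rplus y w * complex_of_real (m w))) \<le>
    4 * K / min 1 (a\<^sup>2) * trunc_weight w"
  using mult_right_mono[OF sym_diff_Rplus_le[OF assms, of w] m_nonneg[of w]] m_nonneg[of w]
  by (auto simp: norm_mult trunc_weight_def indicator_def mult_ac)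

text \<open>Dominated convergence on each half-line beginning at a > 0, where the majorant is
  uniform; local continuity then follows with a = y/2.\<close>

lemma Acal_density_continuous: "continuous_on {0<..} Acal_density"
proof -
  have a: "continuous_on {a<..} Acal_density" if "a > 0" for a
    unfolding Acal_density_def set_lebesgue_integral_def
  proof (intro continuous_on_add continuous_v)
    show "continuous_on {a<..} (\<lambda>y. LINT w|lborel. indicator {0<..} w *\<^sub>R (sym_diff_Rplus y w * complex_of_real (m w)))"
      unfolding continuous_on_sequentially o_def
    proof (intro allI ballI impI, elim conjE)
      fix Y y assume y: "y \<in> {a<..}" and Y: "\<forall>n. Y n \<in> {a<..}" and lim: "Y \<longlonglongrightarrow> y"
      show "(\<lambda>n. LINT w|lborel. indicator {0<..} w *\<^sub>R (sym_diff_Rplus (Y n) w * complex_of_real (m w)))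
          \<longlonglongrightarrow> (LINT w|lborel. indicator {0<..} w *\<^sub>R (sym_diff_Rplus y w * complex_of_real (m w)))"
      proof (rule integral_dominated_convergence)
        show "integrable lborel (\<lambda>w. 4 * K / min 1 (a\<^sup>2) * trunc_weight w)"
          by (intro integrable_mult_right trunc_weight_integrable)
        show "AE w in lborel. norm (indicator {0<..} w *\<^sub>R (sym_diff_Rplus (Y n) w * complex_of_real (m w)))
            \<le> 4 * K / min 1 (a\<^sup>2) * trunc_weight w" for n
          using Y that by (intro AE_I2 norm_sym_diff_weighted_le) (auto intro: less_imp_le)
        have vlim: "(\<lambda>n. v (Y n + c)) \<longlonglongrightarrow> v (y + c)" for c
          by (rule continuous_on_tendsto_compose[OF continuous_v[of UNIV]]) (auto intro!: tendsto_intros lim)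
        \<comment> \<open>The cut-off \<open>w < y\<close> jumps only at w = y, a null set of
          w.\<close>
        have "(\<lambda>n. sym_diff_Rplus (Y n) w) \<longlonglongrightarrow> sym_diff_Rplus y w" if "w \<noteq> y" for w
        proof -
          have base: "(\<lambda>n. v (Y n + 0) - v (Y n + w)) \<longlonglongrightarrow> v (y + 0) - v (y + w)"
            by (intro tendsto_intros vlim)
          show ?thesis
          proof (cases "w < y")
            case True
            have ev: "eventually (\<lambda>n. w < Y n) sequentially"
              using order_tendstoD(1)[OF lim True] .
            have "(\<lambda>n. v (Y n + 0) - v (Y n + w) + (v (Y n + 0) - v (Y n + - w)))
                \<longlonglongrightarrow> v (y + 0) - v (y + w) + (v (y + 0) - v (y + - w))"
              by (intro tendsto_intros vlim)
            then show ?thesis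
              by (rule Lim_transform_eventually[THEN tendsto_cong_limit])
                (use ev True in \<open>auto elim!: eventually_mono simp: sym_diff_Rplus_def\<close>)
          next
            case False
            then have "y < w" using that by simp
            have ev: "eventually (\<lambda>n. Y n < w) sequentially"
              using order_tendstoD(2)[OF lim \<open>y < w\<close>] .
            from base show ?thesis
              by (rule Lim_transform_eventually[THEN tendsto_cong_limit])
                (use ev False in \<open>auto elim!: eventually_mono simp: sym_diff_Rplus_def\<close>)
          qed
        qed
        then show "AE w in lborel. (\<lambda>n. indicator {0<..} w *\<^sub>R (sym_diff_Rplus (Y n) w * complex_of_real (m w)))
            \<longlonglongrightarrow> indicator {0<..} w *\<^sub>R (sym_diff_Rplus y w * complex_of_real (m w))"
          using AE_lborel_singleton[of y] by (auto elim!: eventually_mono intro!: tendsto_intros)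
      qed measurable
    qed
  qed
  show ?thesis
    unfolding continuous_on_eq_continuous_at[OF open_greaterThan]
  proof
    fix y :: real assume "y \<in> {0<..}"
    then show "isCont Acal_density y"
      using a[of "y / 2"] unfolding continuous_on_eq_continuous_at[OF open_greaterThan] by auto
  qed
qed

section \<open>The principal value\<close>

lemma truncated_kernel_integrable:
  assumes "0 < \<epsilon>"
  shows "integrable lborel (\<lambda>w. indicator {\<epsilon><..} \<bar>w\<bar> * m \<bar>w\<bar>)"
proof -
  have Q: "integrable lborel (\<lambda>w. indicator {\<epsilon><..} w * m w)"
  proof (rule Bochner_Integration.integrable_bound)
    show "integrable lborel (\<lambda>w. 1 / min 1 (\<epsilon>\<^sup>2) * trunc_weight w)"
      by (intro integrable_mult_right trunc_weight_integrable)
    have "indicator {\<epsilon><..} w * m w \<le> 1 / min 1 (\<epsilon>\<^sup>2) * trunc_weight w" for w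
    proof (cases "\<epsilon> < w")
      case True
      have "min 1 (\<epsilon>\<^sup>2) \<le> min 1 (w\<^sup>2)"
        using True assms by (intro min.mono power_mono) auto
      then have "1 \<le> 1 / min 1 (\<epsilon>\<^sup>2) * min 1 (w\<^sup>2)"
        using assms by (simp add: pos_le_divide_eq)
      from mult_right_mono[OF this m_nonneg[of w]] show ?thesis
        using True assms by (simp add: trunc_weight_def mult_ac)
    next
      case False
      then show ?thesis using trunc_weight_nonneg[of w] assms by simp
    qed
    then show "AE w in lborel. norm (indicator {\<epsilon><..} w * m w) \<le> norm (1 / min 1 (\<epsilon>\<^sup>2) * trunc_weight w)"
      using m_nonneg trunc_weight_nonneg by (auto simp: abs_mult)
  qed measurable
  have "(\<lambda>w. indicator {\<epsilon><..} \<bar>w\<bar> * m \<bar>w\<bar>) =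
      (\<lambda>w. indicator {\<epsilon><..} w * m w + indicator {\<epsilon><..} (0 + (- 1) * w) * m (0 + (- 1) * w))"
    using assms by (auto simp: indicator_def fun_eq_iff abs_if)
  then show ?thesis
    using Bochner_Integration.integrable_add[OF Q lborel_integrable_real_affine[OF Q, of "- 1" 0]] by simp
qed

text \<open>Put y = x + w and fold the negative w onto the positive ones: the reflected point x - w
  lies in the half-line exactly for w < x, which is the condition in \<open>sym_diff_Rplus\<close>.
  The truncation makes both halves integrable separately, so folding is legitimate.\<close>

lemma truncated_integral_eq:
  assumes "0 < \<epsilon>" "0 < x"
  shows "(LINT y:{0<..}|lborel. (v x - v y) * complex_of_real (indicator {\<epsilon><..} \<bar>x - y\<bar> * m \<bar>x - y\<bar>)) =
    (LINT w|lborel. indicator {0<..} w *\<^sub>R (sym_diff_Rplus x w * complex_of_real (indicator {\<epsilon><..} w * m w)))"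
proof -
  define G where "G y = indicator {0<..} y *\<^sub>R ((v x - v y) * complex_of_real (indicator {\<epsilon><..} \<bar>x - y\<bar> * m \<bar>x - y\<bar>))" for y
  have [measurable]: "G \<in> borel_measurable borel"
    unfolding G_def[abs_def] by measurable
  have int: "integrable lborel (\<lambda>w. G (x + 1 * w))"
  proof (rule Bochner_Integration.integrable_bound)
    show "integrable lborel (\<lambda>w. 2 * K * (indicator {\<epsilon><..} \<bar>w\<bar> * m \<bar>w\<bar>))"
      by (intro integrable_mult_right truncated_kernel_integrable assms)
    have "norm (G (x + 1 * w)) \<le> 2 * K * (indicator {\<epsilon><..} \<bar>w\<bar> * m \<bar>w\<bar>)" for w
    proof -
      have "norm (v x - v (x + w)) \<le> 2 * K"
        using norm_triangle_ineq4[of "v x" "v (x + w)"] v_le_K[of x] v_le_K[of "x + w"] by linarith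
      from mult_right_mono[OF this, of "indicator {\<epsilon><..} \<bar>w\<bar> * m \<bar>w\<bar>"] show ?thesis
        using m_nonneg[of "\<bar>w\<bar>"] K by (auto simp: G_def norm_mult indicator_def)
    qed
    then show "AE w in lborel. norm (G (x + 1 * w)) \<le> norm (2 * K * (indicator {\<epsilon><..} \<bar>w\<bar> * m \<bar>w\<bar>))"
      by (intro AE_I2) (metis abs_ge_self order_trans real_norm_def)
  qed measurable
  have "(LINT y|lborel. G y) = (LINT w|lborel. G (x + 1 * w))"
    using lborel_integral_real_affine[of 1 G x] by simp
  also have "\<dots> = (LINT w:{0<..}|lborel. G (x + 1 * w) + G (x + 1 * - w))"
    by (rule lborel_integral_fold(2)[OF int])
  also have "\<dots> = (LINT w|lborel. indicator {0<..} w *\<^sub>R (sym_diff_Rplus x w * complex_of_real (indicator {\<epsilon><..} w * m w)))"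
    unfolding set_lebesgue_integral_def using assms
    by (intro Bochner_Integration.integral_cong)
      (auto simp: G_def sym_diff_Rplus_def indicator_def distrib_right)
  finally show ?thesis
    by (simp add: G_def[abs_def] set_lebesgue_integral_def)
qed

text \<open>In the folded form the truncated integrands are dominated by the untruncated one. The
  limit is taken along \<epsilon> = \<open>inverse T\<close> with T tending to infinity, the filter
  for which dominated convergence is invoked.\<close>

lemma Acal_density_principal_value:
  assumes "0 < x"
  shows "((\<lambda>\<epsilon>. LINT y:{0<..}|lborel. (v x - v y) * complex_of_real (indicator {\<epsilon><..} \<bar>x - y\<bar> * m \<bar>x - y\<bar>))
      \<longlongrightarrow> Acal_density x - v x) (at_right 0)"
proof -
  let ?s = "\<lambda>T w. indicator {0<..} w *\<^sub>R (sym_diff_Rplus x w * complex_of_real (indicator {inverse T<..} w * m w))"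
  have "((\<lambda>T. LINT w|lborel. ?s T w) \<longlongrightarrow>
      (LINT w|lborel. indicator {0<..} w *\<^sub>R (sym_diff_Rplus x w * complex_of_real (m w)))) at_top"
  proof (rule integral_dominated_convergence_at_top)
    show "integrable lborel (\<lambda>w. 4 * K / min 1 (x\<^sup>2) * trunc_weight w)"
      by (intro integrable_mult_right trunc_weight_integrable)
    have "norm (?s T w) \<le> norm (indicator {0<..} w *\<^sub>R (sym_diff_Rplus x w * complex_of_real (m w)))" for T w
      by (auto simp: indicator_def)
    then have "norm (?s T w) \<le> 4 * K / min 1 (x\<^sup>2) * trunc_weight w" for T w
      using norm_sym_diff_weighted_le[OF assms order_refl, of w] by (meson order_trans)
    then show "\<forall>\<^sub>F T in at_top. AE w in lborel. norm (?s T w) \<le> 4 * K / min 1 (x\<^sup>2) * trunc_weight w"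
      by simp
    have "((\<lambda>T. ?s T w) \<longlongrightarrow> indicator {0<..} w *\<^sub>R (sym_diff_Rplus x w * complex_of_real (m w))) at_top" for w
    proof (cases "w > 0")
      case True
      have "\<forall>\<^sub>F T in at_top. inverse T < w"
        using order_tendstoD(2)[OF tendsto_inverse_0_at_top[OF filterlim_ident] True] .
      then show ?thesis
        by (intro tendsto_eventually) (auto elim!: eventually_mono)
    qed simp
    then show "AE w in lborel. ((\<lambda>T. ?s T w) \<longlongrightarrow> indicator {0<..} w *\<^sub>R (sym_diff_Rplus x w * complex_of_real (m w))) at_top"
      by simp
  qed measurable
  moreover have "\<forall>\<^sub>F T in at_top. (LINT w|lborel. ?s T w) =
      (LINT y:{0<..}|lborel. (v x - v y) * complex_of_real (indicator {inverse T<..} \<bar>x - y\<bar> * m \<bar>x - y\<bar>))"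
    using eventually_gt_at_top[of 0] by eventually_elim (rule truncated_integral_eq[OF _ assms, symmetric], simp)
  ultimately show ?thesis
    unfolding filterlim_at_right_to_top
    by (simp add: Acal_density_def set_lebesgue_integral_def Lim_transform_eventually)
qed

end

section \<open>Translations and the density of the pairing\<close>

lemma lborel_integral_shift:
  fixes f :: "real \<Rightarrow> 'a::{banach, second_countable_topology}"
  shows "(LINT x|lborel. f (x + c)) = (LINT x|lborel. f x)"
    and "integrable lborel (\<lambda>x. f (x + c)) \<longleftrightarrow> integrable lborel f"
proof -
  have eq: "(\<lambda>x. f (x + c)) = (\<lambda>x. f (c + 1 * x))"
    by (simp add: add.commute)
  show "(LINT x|lborel. f (x + c)) = (LINT x|lborel. f x)"
    unfolding eq using lborel_integral_real_affine[of 1 f c, symmetric] by simp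
  show "integrable lborel (\<lambda>x. f (x + c)) \<longleftrightarrow> integrable lborel f"
    unfolding eq by (rule lborel_integrable_real_affine_iff) simp
qed

text \<open>The shear (x, y) to (x + y, y) preserves the measure. This handles integrands
  concentrated along x + w in the support of a function, which have no suitable product
  majorant.\<close>

lemma integrable_pair_shear_bound:
  fixes F :: "real \<times> real \<Rightarrow> 'a::{banach, second_countable_topology}" and g k :: "real \<Rightarrow> real"
  assumes F: "F \<in> borel_measurable (lborel \<Otimes>\<^sub>M lborel)"
    and g: "integrable lborel g" and k: "integrable lborel k"
    and le: "\<And>x y. norm (F (x, y)) \<le> g (x + y) * k y"
  shows "integrable (lborel \<Otimes>\<^sub>M lborel) F"
proof (rule Bochner_Integration.integrable_bound)
  have [measurable]: "g \<in> borel_measurable borel" "k \<in> borel_measurable borel"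
    using g k by auto
  have "integrable (lborel \<Otimes>\<^sub>M lborel) (\<lambda>(y, x). g (x + y) * k y)"
  proof (rule lborel_pair.Fubini_integrable)
    show "(\<lambda>(y, x). g (x + y) * k y) \<in> borel_measurable (lborel \<Otimes>\<^sub>M lborel)"
      by measurable
    show "integrable lborel (\<lambda>y. LINT x|lborel. norm (case (y, x) of (y, x) \<Rightarrow> g (x + y) * k y))"
      using k lborel_integral_shift(1)[of "\<lambda>x. \<bar>g x\<bar>"] by (simp add: abs_mult)
  qed (use g in \<open>simp add: lborel_integral_shift(2)\<close>)
  from lborel_pair.integrable_product_swap[OF this]
  show "integrable (lborel \<Otimes>\<^sub>M lborel) (\<lambda>(x, y). g (x + y) * k y)"
    by simp
  have "norm (F (x, y)) \<le> norm (g (x + y) * k y)" for x y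
    using le[of x y] by (metis abs_ge_self order_trans real_norm_def)
  then show "AE z in lborel \<Otimes>\<^sub>M lborel. norm (F z) \<le> norm (case z of (x, y) \<Rightarrow> g (x + y) * k y)"
    by (auto split: prod.splits)
qed (fact F)

context schwartz_half_line
begin

lemma Acal_pairing_eq:
  assumes \<phi>: "test_fun_Rplus \<phi>"
  shows "Acal_pairing \<alpha> v \<phi> = (LINT x:{0<..}|lborel. Acal_density x * \<phi> x)"
proof -
  obtain a b where smooth_\<phi>: "smooth_fun \<phi>" and a: "0 < a" and supp: "supported_in a b \<phi>"
    using \<phi> unfolding test_fun_Rplus_def supported_in_def by blast
  have \<phi>_zero: "\<phi> y = 0" if "y < a" for y
    using supp that by (auto simp: supported_in_def)
  have cont: "continuous_on UNIV \<phi>"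
    using continuous_on_vderiv_iter[OF smooth_\<phi>, of UNIV 0] by simp
  have [measurable]: "\<phi> \<in> borel_measurable borel"
    by (intro borel_measurable_continuous_onI cont)
  have \<phi>_int: "integrable lborel \<phi>"
    by (rule supported_in_integrable[OF cont supp])
  obtain B0 B2 where B: "B0 \<ge> 0" "\<And>x. norm (\<phi> x) \<le> B0" "B2 \<ge> 0" "\<And>x. norm (vderiv_iter 2 \<phi> x) \<le> B2"
    using supported_in_bounded[OF cont supp]
      supported_in_bounded[OF continuous_on_vderiv_iter[OF smooth_\<phi>] supported_in_vderiv_iter[OF supp], of 2]
    by metis
  have \<phi>_second: "norm (2 * \<phi> x - \<phi> (x + w) - \<phi> (x - w)) \<le> 4 * (B0 + B2) * min 1 (w\<^sup>2)" for x w
  proof (rule second_difference_le)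
    show "(\<phi> has_vector_derivative vderiv_iter 1 \<phi> x) (at x)"
      "(vderiv_iter 1 \<phi> has_vector_derivative vderiv_iter 2 \<phi> x) (at x)" for x
      using smooth_fun_has_vector_derivative[OF smooth_\<phi>, of 0 x] smooth_fun_has_vector_derivative[OF smooth_\<phi>, of 1 x]
      by (simp_all add: numeral_2_eq_2)
    show "norm (\<phi> x) \<le> B0 + B2" "norm (vderiv_iter 2 \<phi> x) \<le> B0 + B2" for x
      using B(1,3) B(2)[of x] B(4)[of x] by auto
  qed
  define \<psi> where "\<psi> y = v y * \<phi> y" for y
  have smooth_\<psi>: "smooth_fun \<psi>"
    unfolding \<psi>_def[abs_def] by (intro smooth_fun_mult smooth smooth_\<phi>)
  have supp_\<psi>: "supported_in a b \<psi>"
    using supp by (simp add: supported_in_def \<psi>_def)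
  have \<psi>_zero: "\<psi> y = 0" if "y < a" for y
    using \<phi>_zero[OF that] by (simp add: \<psi>_def)
  have [measurable]: "\<psi> \<in> borel_measurable borel"
    unfolding \<psi>_def[abs_def] by measurable
  have times_\<phi>_int: "integrable lborel (\<lambda>y. g y * \<phi> y)"
    if "g \<in> borel_measurable borel" "\<And>y. norm (g y) \<le> K" for g
  proof (rule Bochner_Integration.integrable_bound)
    show "integrable lborel (\<lambda>y. K * norm (\<phi> y))" using \<phi>_int by simp
    show "AE y in lborel. norm (g y * \<phi> y) \<le> norm (K * norm (\<phi> y))"
      using that(2) K by (auto simp: norm_mult abs_mult intro!: mult_right_mono)
  qed (use that(1) in measurable)
  have \<psi>_int: "integrable lborel \<psi>"
    unfolding \<psi>_def[abs_def] by (rule times_\<phi>_int) (auto intro: v_le_K)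

  \<comment> \<open>\<open>F1\<close> belongs to the zero extension of u, \<open>F2\<close> to the
    term with the characteristic function, and \<open>F3\<close> to the density without its leading
    summand v.\<close>
  define F1 where "F1 x w = (indicator {0<..} x *\<^sub>R v x) *
      (indicator {0<..} w *\<^sub>R ((2 * \<phi> x - \<phi> (x + w) - \<phi> (x - w)) * complex_of_real (m w)))" for x w
  define F2 where "F2 x w = indicator {..<0} x *\<^sub>R (indicator {0<..} w *\<^sub>R (- \<psi> (x + w) * complex_of_real (m w)))" for x w
  define F3 where "F3 y w = (indicator {0<..} y *\<^sub>R \<phi> y) *
      (indicator {0<..} w *\<^sub>R (sym_diff_Rplus y w * complex_of_real (m w)))" for y w

  have F1_int: "integrable (lborel \<Otimes>\<^sub>M lborel) (\<lambda>(x, w). F1 x w)"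
  proof (rule integrable_pair_bound)
    show "(\<lambda>(x, w). F1 x w) \<in> borel_measurable (lborel \<Otimes>\<^sub>M lborel)"
      unfolding F1_def by measurable
    show "integrable lborel (\<lambda>x. norm (v x))" "integrable lborel (\<lambda>w. 4 * (B0 + B2) * trunc_weight w)"
      using v_integrable trunc_weight_integrable by auto
    show "norm (case (x, w) of (x, w) \<Rightarrow> F1 x w) \<le> norm (v x) * (4 * (B0 + B2) * trunc_weight w)" for x w
    proof -
      have "norm (2 * \<phi> x - \<phi> (x + w) - \<phi> (x - w)) * m w \<le> 4 * (B0 + B2) * min 1 (w\<^sup>2) * m w"
        by (intro mult_right_mono \<phi>_second m_nonneg)
      then have "norm (indicator {0<..} w *\<^sub>R ((2 * \<phi> x - \<phi> (x + w) - \<phi> (x - w)) * complex_of_real (m w)))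
          \<le> 4 * (B0 + B2) * trunc_weight w"
        using m_nonneg[of w] by (auto simp: norm_mult trunc_weight_def indicator_def mult_ac)
      moreover have "norm (indicator {0<..} x *\<^sub>R v x) \<le> norm (v x)"
        by (simp add: indicator_def)
      ultimately show ?thesis
        unfolding prod.case F1_def norm_mult[of "indicator {0<..} x *\<^sub>R v x"] by (intro mult_mono) auto
    qed
  qed
  have F2_int: "integrable (lborel \<Otimes>\<^sub>M lborel) (\<lambda>(x, w). F2 x w)"
  proof (rule integrable_pair_shear_bound)
    show "(\<lambda>(x, w). F2 x w) \<in> borel_measurable (lborel \<Otimes>\<^sub>M lborel)"
      unfolding F2_def by measurable
    show "integrable lborel (\<lambda>x. norm (\<psi> x))" "integrable lborel (\<lambda>w. 1 / min 1 (a\<^sup>2) * trunc_weight w)"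
      using \<psi>_int trunc_weight_integrable by auto
    \<comment> \<open>A jump from x < 0 into the support of \<psi> has length at least
      \<open>a\<close>, so the singularity of the kernel is never reached.\<close>
    show "norm (case (x, w) of (x, w) \<Rightarrow> F2 x w) \<le> norm (\<psi> (x + w)) * (1 / min 1 (a\<^sup>2) * trunc_weight w)" for x w
    proof (cases "x < 0 \<and> a \<le> w")
      case True
      have "min 1 (a\<^sup>2) \<le> min 1 (w\<^sup>2)"
        using True a by (intro min.mono power_mono) auto
      then have "1 \<le> 1 / min 1 (a\<^sup>2) * min 1 (w\<^sup>2)"
        using a by (simp add: pos_le_divide_eq)
      from mult_right_mono[OF this m_nonneg[of w]] have "m w \<le> 1 / min 1 (a\<^sup>2) * trunc_weight w"
        using True a by (simp add: trunc_weight_def mult_ac)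
      from mult_left_mono[OF this norm_ge_zero[of "\<psi> (x + w)"]] show ?thesis
        using True a m_nonneg[of w] by (simp add: F2_def norm_mult)
    next
      case False
      then have "F2 x w = 0"
        using \<psi>_zero[of "x + w"] by (auto simp: F2_def indicator_def)
      then show ?thesis
        using trunc_weight_nonneg[of w] a by simp
    qed
  qed
  have F3_int: "integrable (lborel \<Otimes>\<^sub>M lborel) (\<lambda>(y, w). F3 y w)"
  proof (rule integrable_pair_bound)
    show "(\<lambda>(y, w). F3 y w) \<in> borel_measurable (lborel \<Otimes>\<^sub>M lborel)"
      unfolding F3_def by measurable
    show "integrable lborel (\<lambda>y. norm (\<phi> y))" "integrable lborel (\<lambda>w. 4 * K / min 1 (a\<^sup>2) * trunc_weight w)"
      using \<phi>_int trunc_weight_integrable by auto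
    show "norm (case (y, w) of (y, w) \<Rightarrow> F3 y w) \<le> norm (\<phi> y) * (4 * K / min 1 (a\<^sup>2) * trunc_weight w)" for y w
    proof (cases "a \<le> y")
      case True
      have "norm (indicator {0<..} y *\<^sub>R \<phi> y) \<le> norm (\<phi> y)"
        by (simp add: indicator_def)
      then show ?thesis
        unfolding prod.case F3_def norm_mult[of "indicator {0<..} y *\<^sub>R \<phi> y"]
        by (intro mult_mono norm_sym_diff_weighted_le[OF a True]) auto
    next
      case False
      then show ?thesis
        using K a trunc_weight_nonneg[of w] by (simp add: F3_def \<phi>_zero)
    qed
  qed

  have P1: "(LINT x:{0<..}|lborel. v x * Aop \<alpha> \<phi> x) = (LINT x:{0<..}|lborel. \<psi> x) + (LINT x|lborel. LINT w|lborel. F1 x w)"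
  proof -
    have "indicator {0<..} x *\<^sub>R (v x * Aop \<alpha> \<phi> x) = indicator {0<..} x *\<^sub>R \<psi> x + (LINT w|lborel. F1 x w)" for x
      unfolding F1_def Aop_eq_second_difference[OF \<alpha> smooth_\<phi> supp] set_lebesgue_integral_def integral_mult_right_zero
      by (simp add: \<psi>_def distrib_left scaleR_add_right)
    moreover have "integrable lborel (\<lambda>x. indicator {0<..} x *\<^sub>R \<psi> x)"
      by (intro integrable_mult_indicator \<psi>_int) simp
    ultimately show ?thesis
      unfolding set_lebesgue_integral_def
      using Bochner_Integration.integral_add[OF _ lborel_pair.integrable_fst'[OF F1_int]] by simp
  qed
  \<comment> \<open>For x < 0 both x and x - w lie left of the support of \<psi>, so only the
    forward term of the second difference survives.\<close>
  have P2: "(LINT x:{..<0}|lborel. Aop \<alpha> (\<lambda>y. v y * \<phi> y) x) = (LINT x|lborel. LINT w|lborel. F2 x w)"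
  proof -
    have "indicator {..<0} x *\<^sub>R Aop \<alpha> \<psi> x = (LINT w|lborel. F2 x w)" for x
    proof (cases "x < 0")
      case True
      have "indicator {0<..} w *\<^sub>R ((2 * \<psi> x - \<psi> (x + w) - \<psi> (x - w)) * complex_of_real (m w)) =
          indicator {0<..} w *\<^sub>R (- \<psi> (x + w) * complex_of_real (m w))" for w
        using True a \<psi>_zero[of x] \<psi>_zero[of "x - w"] by (auto simp: indicator_def)
      moreover have "\<psi> x = 0" using True a by (intro \<psi>_zero) simp
      ultimately have "Aop \<alpha> \<psi> x = (LINT w:{0<..}|lborel. - \<psi> (x + w) * complex_of_real (m w))"
        unfolding Aop_eq_second_difference[OF \<alpha> smooth_\<psi> supp_\<psi>] set_lebesgue_integral_def by simp
      then show ?thesis using True by (simp add: F2_def set_lebesgue_integral_def)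
    qed (simp add: F2_def)
    then show ?thesis
      by (simp add: set_lebesgue_integral_def \<psi>_def[abs_def])
  qed
  have swap: "(LINT x|lborel. F1 x w) + (LINT x|lborel. F2 x w) = (LINT y|lborel. F3 y w)" for w
  proof (cases "w > 0")
    case w: True
    \<comment> \<open>These are the single terms after moving the translation from \<phi> to v.
      \<open>A1\<close> carries v(y - w), whose argument was positive, hence y > w;
      \<open>A3\<close> collects the mass that jumps of length w carry out of the half-line. Each is
      integrable in y, but multiplied by m it need not be integrable in w, so the split is made at
      fixed w.\<close>
    define A0 A1 A2 A3 where "A0 y = indicator {0<..} y *\<^sub>R (2 * \<psi> y)"
      and "A1 y = indicator {w<..} y *\<^sub>R (v (y - w) * \<phi> y)"
      and "A2 y = indicator {- w<..} y *\<^sub>R (v (y + w) * \<phi> y)"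
      and "A3 y = indicator {..<w} y *\<^sub>R \<psi> y" for y
    have A_int: "integrable lborel A0" "integrable lborel A1" "integrable lborel A2" "integrable lborel A3"
      unfolding A0_def[abs_def] A1_def[abs_def] A2_def[abs_def] A3_def[abs_def]
      by (intro integrable_mult_indicator integrable_mult_right \<psi>_int times_\<phi>_int v_le_K; measurable)+
    have "(LINT x|lborel. F1 x w) = (LINT x|lborel. complex_of_real (m w) * (A0 x - A1 (x + w) - A2 (x + - w)))"
      using w by (intro Bochner_Integration.integral_cong)
        (auto simp: F1_def A0_def A1_def A2_def \<psi>_def indicator_def algebra_simps)
    also have "\<dots> = complex_of_real (m w) * ((LINT x|lborel. A0 x) - (LINT x|lborel. A1 x) - (LINT x|lborel. A2 x))"
      using A_int lborel_integral_shift[of A1 w] lborel_integral_shift[of A2 "- w"] by simp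
    finally have 1: "(LINT x|lborel. F1 x w) = \<dots>" .
    have "(LINT x|lborel. F2 x w) = (LINT x|lborel. complex_of_real (m w) * - A3 (x + w))"
      using w by (intro Bochner_Integration.integral_cong) (auto simp: F2_def A3_def indicator_def)
    also have "\<dots> = complex_of_real (m w) * - (LINT x|lborel. A3 x)"
      using A_int lborel_integral_shift[of A3 w] by simp
    finally have 2: "(LINT x|lborel. F2 x w) = \<dots>" .
    have "(LINT y|lborel. F3 y w) = (LINT y|lborel. complex_of_real (m w) * (A0 y - A1 y - A2 y - A3 y))"
    proof (rule integral_cong_AE)
      \<comment> \<open>On {y < w} the term \<open>A3\<close> removes one of the two copies of
        \<psi> in \<open>A0\<close>. At y = w the strict inequalities on both sides miss the point,
        so the identity holds only almost everywhere.\<close>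
      have "F3 y w = complex_of_real (m w) * (A0 y - A1 y - A2 y - A3 y)" if "y \<noteq> w" for y
      proof (cases "y < a")
        case True
        then show ?thesis
          by (simp add: F3_def A0_def A1_def A2_def A3_def \<phi>_zero \<psi>_zero)
      next
        case False
        then show ?thesis
          using w a that by (auto simp: F3_def A0_def A1_def A2_def A3_def sym_diff_Rplus_def \<psi>_def indicator_def algebra_simps)
      qed
      then show "AE y in lborel. F3 y w = complex_of_real (m w) * (A0 y - A1 y - A2 y - A3 y)"
        using AE_lborel_singleton[of w] by (auto elim!: eventually_mono)
      show "(\<lambda>y. F3 y w) \<in> borel_measurable lborel"
        unfolding F3_def sym_diff_Rplus_def by measurable
      show "(\<lambda>y. complex_of_real (m w) * (A0 y - A1 y - A2 y - A3 y)) \<in> borel_measurable lborel"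
        using A_int by (intro borel_measurable_times borel_measurable_diff borel_measurable_const) auto
    qed
    also have "\<dots> = complex_of_real (m w) *
        ((LINT x|lborel. A0 x) - (LINT x|lborel. A1 x) - (LINT x|lborel. A2 x) - (LINT x|lborel. A3 x))"
      using A_int by simp
    finally show ?thesis
      unfolding 1 2 by (simp add: right_diff_distrib)
  qed (simp add: F1_def F2_def F3_def)
  have F3_w: "(LINT w|lborel. F3 y w) = indicator {0<..} y *\<^sub>R (Acal_density y * \<phi> y) - indicator {0<..} y *\<^sub>R \<psi> y" for y
    unfolding F3_def integral_mult_right_zero
    by (simp add: Acal_density_def \<psi>_def set_lebesgue_integral_def algebra_simps)
  have "Acal_pairing \<alpha> v \<phi> = (LINT x:{0<..}|lborel. \<psi> x) +
      ((LINT x|lborel. LINT w|lborel. F1 x w) + (LINT x|lborel. LINT w|lborel. F2 x w))"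
    unfolding Acal_pairing_def P1 P2 by simp
  also have "(LINT x|lborel. LINT w|lborel. F1 x w) + (LINT x|lborel. LINT w|lborel. F2 x w) =
      (LINT w|lborel. LINT x|lborel. F1 x w) + (LINT w|lborel. LINT x|lborel. F2 x w)"
    using lborel_pair.Fubini_integral[OF F1_int] lborel_pair.Fubini_integral[OF F2_int] by simp
  also have "\<dots> = (LINT w|lborel. (LINT x|lborel. F1 x w) + (LINT x|lborel. F2 x w))"
    using lborel_pair.integrable_snd[OF F1_int] lborel_pair.integrable_snd[OF F2_int]
    by (intro Bochner_Integration.integral_add[symmetric])
  also have "\<dots> = (LINT y|lborel. LINT w|lborel. F3 y w)"
    unfolding swap by (rule lborel_pair.Fubini_integral[OF F3_int])
  also have "(LINT x:{0<..}|lborel. \<psi> x) + \<dots> =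
      (LINT y|lborel. indicator {0<..} y *\<^sub>R \<psi> y + (LINT w|lborel. F3 y w))"
    unfolding set_lebesgue_integral_def
    using lborel_pair.integrable_fst'[OF F3_int] integrable_mult_indicator[OF _ \<psi>_int, of "{0<..}"]
    by (subst Bochner_Integration.integral_add) auto
  finally show ?thesis
    unfolding F3_w by (simp add: set_lebesgue_integral_def)
qed

text \<open>\<open>Acal_density\<close> is the witness that gives the choice operator its defining
  property; uniqueness of continuous densities then identifies the chosen function. The defining
  property constrains it only for x > 0.\<close>

lemma Acal_eq:
  assumes "0 < x"
  shows "Acal \<alpha> v x = Acal_density x"
proof -
  let ?P = "\<lambda>h. continuous_on {0<..} h \<and>
    (\<forall>\<phi>. test_fun_Rplus \<phi> \<longrightarrow> Acal_pairing \<alpha> v \<phi> = (LINT x:{0<..}|lborel. h x * \<phi> x))"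
  have P: "?P Acal_density"
    using Acal_density_continuous Acal_pairing_eq by blast
  have "?P (SOME h. ?P h)"
    by (rule someI[of ?P, OF P])
  then have "?P (Acal \<alpha> v)"
    unfolding Acal_def .
  then have cont: "continuous_on {0<..} (Acal \<alpha> v)"
    and pairing: "\<And>\<phi>. test_fun_Rplus \<phi> \<Longrightarrow>
      Acal_pairing \<alpha> v \<phi> = (LINT x:{0<..}|lborel. Acal \<alpha> v x * \<phi> x)"
    by blast+
  show ?thesis
    by (rule test_fun_pairing_determines_continuous[OF cont Acal_density_continuous _ assms])
      (rule trans[OF pairing[symmetric] Acal_pairing_eq])
qed

end

section \<open>The quadratic form\<close>

lemma min_one_power2: "(min 1 w)\<^sup>2 = min 1 (w\<^sup>2)" if "0 \<le> w" for w :: real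
proof (cases "w \<le> 1")
  case True
  then show ?thesis using power_le_one[of w 2] that by simp
next
  case False
  then show ?thesis using one_le_power[of w 2] by simp
qed

context schwartz_half_line
begin

text \<open>The part y > x of the double integral in the coordinate w = y - x; the part y < x is
  recovered by symmetry.\<close>

definition energy_density :: "real \<Rightarrow> real \<Rightarrow> real" where
  "energy_density x w = indicator {0<..} x * indicator {0<..} w * ((cmod (v x - v (x + w)))\<^sup>2 * m w)"

lemma energy_density_measurable [measurable]:
  "(\<lambda>(x, w). energy_density x w) \<in> borel_measurable (borel \<Otimes>\<^sub>M borel)"
  unfolding energy_density_def by measurable

lemma energy_density_nonneg: "0 \<le> energy_density x w"
  by (simp add: energy_density_def m_nonneg)

lemma cnj_v_measurable [measurable]: "(\<lambda>x. cnj (v x)) \<in> borel_measurable borel"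
  by (intro borel_measurable_continuous_onI continuous_on_cnj continuous_v)

text \<open>Squaring the first-order bound yields min(1, w^2). Of the two factors 1/(1 + x^2) one
  gives integrability in x, the other is estimated by 1.\<close>

lemma energy_density_integrable: "integrable (lborel \<Otimes>\<^sub>M lborel) (\<lambda>(x, w). energy_density x w)"
proof (rule integrable_pair_bound)
  show "(\<lambda>(x, w). energy_density x w) \<in> borel_measurable (lborel \<Otimes>\<^sub>M lborel)"
    by measurable
  show "integrable lborel (\<lambda>x::real. 4 * K * K * (1 / (1 + x\<^sup>2)))"
    by (intro integrable_mult_right integrable_inverse_one_plus_square)
  show "integrable lborel trunc_weight"
    by (rule trunc_weight_integrable)
  show "norm (case (x, w) of (x, w) \<Rightarrow> energy_density x w) \<le> 4 * K * K * (1 / (1 + x\<^sup>2)) * trunc_weight w" for x w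
  proof (cases "0 < x \<and> 0 < w")
    case True
    have x: "1 / (1 + x\<^sup>2) \<le> 1" by (simp add: divide_le_eq_1 add_pos_nonneg)
    have "(cmod (v x - v (x + w)))\<^sup>2 \<le> (2 * K / (1 + x\<^sup>2) * min 1 w)\<^sup>2"
      using True by (intro power_mono diff_le) auto
    also have "\<dots> = 4 * K * K * (1 / (1 + x\<^sup>2)) * (1 / (1 + x\<^sup>2)) * min 1 (w\<^sup>2)"
      using True by (simp add: power_mult_distrib power_divide min_one_power2) (simp add: power2_eq_square)
    also have "\<dots> \<le> 4 * K * K * (1 / (1 + x\<^sup>2)) * 1 * min 1 (w\<^sup>2)"
      using K by (intro mult_right_mono mult_left_mono x) auto
    finally have "(cmod (v x - v (x + w)))\<^sup>2 * m w \<le> 4 * K * K * (1 / (1 + x\<^sup>2)) * 1 * min 1 (w\<^sup>2) * m w"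
      by (intro mult_right_mono m_nonneg)
    then show ?thesis
      using True m_nonneg[of w] by (simp add: energy_density_def trunc_weight_def mult_ac)
  next
    case False
    have "0 \<le> 4 * K * K * (1 / (1 + x\<^sup>2)) * trunc_weight w"
      using K trunc_weight_nonneg[of w] by (intro mult_nonneg_nonneg) auto
    then show ?thesis using False by (auto simp: energy_density_def)
  qed
qed

definition form_density :: "real \<Rightarrow> real \<Rightarrow> complex" where
  "form_density x w = (indicator {0<..} x *\<^sub>R cnj (v x)) *
    (indicator {0<..} w *\<^sub>R (sym_diff_Rplus x w * complex_of_real (m w)))"

text \<open>In the strip 0 < x \<le> w only min(1, w) is available, which m does not tolerate for
  large \<alpha>. Integrating over x first gives at most a multiple of min(1, w), by the length of
  the strip for small w and by the total mass \<open>c\<close> for large w; the product is min(1,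
  w^2) again. The factor 1 + c covers both ranges.\<close>

lemma far_weight_integrable:
  "integrable (lborel \<Otimes>\<^sub>M lborel)
    (\<lambda>(x, w). (if 0 < x \<and> x \<le> w then 1 / (1 + x\<^sup>2) else 0) * (indicator {0<..} w * (min 1 w * m w)))"
proof -
  define c where "c = (LINT x|lborel. 1 / (1 + x\<^sup>2) :: real)"
  define T where "T w x = (if 0 < x \<and> x \<le> w then 1 / (1 + x\<^sup>2) else 0)" for w x :: real
  have [measurable]: "(\<lambda>(w, x). T w x) \<in> borel_measurable (borel \<Otimes>\<^sub>M borel)"
    unfolding T_def by measurable
  have T_nonneg: "0 \<le> T w x" for w x
    by (simp add: T_def)
  have T_int: "integrable lborel (T w)" for w
    by (rule Bochner_Integration.integrable_bound[OF integrable_inverse_one_plus_square])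
      (auto simp: T_def[abs_def])
  have T_le: "(LINT x|lborel. T w x) \<le> (1 + c) * min 1 w" if "0 < w" for w
  proof -
    have "(LINT x|lborel. T w x) \<le> c"
      unfolding c_def by (rule integral_mono[OF T_int integrable_inverse_one_plus_square]) (simp add: T_def)
    moreover have "(LINT x|lborel. T w x) \<le> (LINT x|lborel. indicator {0..w} x)"
      by (rule integral_mono[OF T_int integrable_real_indicator]) (use that in \<open>auto simp: T_def indicator_def divide_le_eq_1 add_pos_nonneg\<close>)
    moreover have "(LINT x|lborel. indicator {0..w} x) = w"
      using that by simp
    moreover have "0 \<le> (LINT x|lborel. T w x)"
      by (intro integral_nonneg_AE AE_I2 T_nonneg)
    ultimately have *: "(LINT x|lborel. T w x) \<le> c" "(LINT x|lborel. T w x) \<le> w" "0 \<le> c"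
      by auto
    have "0 \<le> c * w" using * that by simp
    moreover have "(1 + c) * min 1 w = (if 1 \<le> w then 1 + c else w + c * w)"
      by (simp add: min_def distrib_right)
    ultimately show ?thesis
      using * by (simp only: split: if_split) linarith
  qed
  define k where "k w = indicator {0<..} w * (min 1 w * m w)" for w
  have [measurable]: "k \<in> borel_measurable borel"
    unfolding k_def[abs_def] by measurable
  have k_nonneg: "0 \<le> k w" for w
    by (simp add: k_def indicator_def m_nonneg)
  have "integrable (lborel \<Otimes>\<^sub>M lborel) (\<lambda>(w, x). T w x * k w)"
  proof (rule lborel_pair.Fubini_integrable)
    show "(\<lambda>(w, x). T w x * k w) \<in> borel_measurable (lborel \<Otimes>\<^sub>M lborel)"
      by measurable
    have "integrable lborel (\<lambda>w. (LINT x|lborel. T w x) * k w)"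
    proof (rule Bochner_Integration.integrable_bound)
      show "integrable lborel (\<lambda>w. (1 + c) * trunc_weight w)"
        by (intro integrable_mult_right trunc_weight_integrable)
      have "norm ((LINT x|lborel. T w x) * k w) \<le> (1 + c) * trunc_weight w" for w
      proof (cases "0 < w")
        case True
        have "0 \<le> (LINT x|lborel. T w x)"
          by (intro integral_nonneg_AE AE_I2 T_nonneg)
        then have "norm ((LINT x|lborel. T w x) * k w) = (LINT x|lborel. T w x) * k w"
          using k_nonneg[of w] by simp
        also have "\<dots> \<le> (1 + c) * min 1 w * k w"
          by (intro mult_right_mono T_le True k_nonneg)
        also have "\<dots> = (1 + c) * trunc_weight w"
          using True min_one_power2[of w] by (simp add: k_def trunc_weight_def power2_eq_square[of "min 1 w"])
        finally show ?thesis .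
      qed (simp add: k_def trunc_weight_def)
      then show "AE w in lborel. norm ((LINT x|lborel. T w x) * k w) \<le> norm ((1 + c) * trunc_weight w)"
        by (intro AE_I2) (metis abs_ge_self order_trans real_norm_def)
    qed measurable
    then show "integrable lborel (\<lambda>w. LINT x|lborel. norm (case (w, x) of (w, x) \<Rightarrow> T w x * k w))"
      using T_nonneg k_nonneg by (simp add: abs_mult)
  qed (use T_int in simp)
  from lborel_pair.integrable_product_swap[OF this] show ?thesis
    by (simp add: T_def k_def)
qed

text \<open>For w < x the second-order bound gives the product majorant \<open>?S\<close>; for x
  \<le> w the first-order bound leads to the strip weight \<open>?T\<close>.\<close>

lemma form_density_integrable: "integrable (lborel \<Otimes>\<^sub>M lborel) (\<lambda>(x, w). form_density x w)"
proof (rule Bochner_Integration.integrable_bound)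
  let ?T = "\<lambda>x w. (if 0 < x \<and> x \<le> w then 1 / (1 + x\<^sup>2) else 0) * (indicator {0<..} w * (min 1 w * m w))"
  let ?S = "\<lambda>x w. K * (1 / (1 + x\<^sup>2)) * (4 * K * trunc_weight w)"
  have S: "integrable (lborel \<Otimes>\<^sub>M lborel) (\<lambda>(x, w). ?S x w)"
  proof (rule integrable_pair_bound)
    show "integrable lborel (\<lambda>x::real. K * (1 / (1 + x\<^sup>2)))" "integrable lborel (\<lambda>w. 4 * K * trunc_weight w)"
      by (intro integrable_mult_right integrable_inverse_one_plus_square trunc_weight_integrable)+
    show "norm (case (x, w) of (x, w) \<Rightarrow> ?S x w) \<le> ?S x w" for x w
      using K trunc_weight_nonneg[of w] by (simp add: abs_mult)
    show "(\<lambda>(x, w). ?S x w) \<in> borel_measurable (lborel \<Otimes>\<^sub>M lborel)"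
      by measurable
  qed
  show "integrable (lborel \<Otimes>\<^sub>M lborel) (\<lambda>z. (case z of (x, w) \<Rightarrow> ?S x w) + 2 * K * K * (case z of (x, w) \<Rightarrow> ?T x w))"
    by (intro Bochner_Integration.integrable_add S integrable_mult_right far_weight_integrable)
  have "norm (form_density x w) \<le> ?S x w + 2 * K * K * ?T x w" for x w
  proof (cases "0 < x \<and> 0 < w")
    case True
    have x: "0 < 1 + x\<^sup>2" by (simp add: add_pos_nonneg)
    have eq: "norm (form_density x w) = norm (v x) * (norm (sym_diff_Rplus x w) * m w)"
      using True m_nonneg[of w] by (simp add: form_density_def norm_mult)
    show ?thesis
    proof (cases "w < x")
      case near: True
      have "norm (v x) * (norm (sym_diff_Rplus x w) * m w) \<le> K / (1 + x\<^sup>2) * (4 * K * min 1 (w\<^sup>2) * m w)"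
        using K x m_nonneg[of w] by (intro mult_mono v_le mult_right_mono sym_diff_Rplus_le_near near) auto
      then show ?thesis
        using near True eq by (simp add: trunc_weight_def)
    next
      case False
      have "norm (v x) * (norm (sym_diff_Rplus x w) * m w) \<le> K / (1 + x\<^sup>2) * (2 * K * min 1 w * m w)"
        using K x m_nonneg[of w] True False
        by (intro mult_mono v_le mult_right_mono sym_diff_Rplus_le_far) auto
      also have "\<dots> = 2 * K * K * ?T x w"
        using True False by simp
      also have "\<dots> \<le> ?S x w + 2 * K * K * ?T x w"
        using K trunc_weight_nonneg[of w] x by simp
      finally show ?thesis unfolding eq .
    qed
  next
    case False
    have "0 \<le> ?S x w" "0 \<le> 2 * K * K * ?T x w"
      using K trunc_weight_nonneg[of w] m_nonneg[of w] by (auto simp: indicator_def)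
    then show ?thesis using False by (auto simp: form_density_def)
  qed
  then have "norm (form_density x w) \<le> norm (?S x w + 2 * K * K * ?T x w)" for x w
    by (rule order_trans) (simp only: real_norm_def abs_ge_self)
  then show "AE z in lborel \<Otimes>\<^sub>M lborel. norm (case z of (x, w) \<Rightarrow> form_density x w) \<le>
      norm ((case z of (x, w) \<Rightarrow> ?S x w) + 2 * K * K * (case z of (x, w) \<Rightarrow> ?T x w))"
    by (intro AE_I2) (simp only: split_paired_all prod.case)
  show "(\<lambda>(x, w). form_density x w) \<in> borel_measurable (lborel \<Otimes>\<^sub>M lborel)"
    unfolding form_density_def by measurable
qed

text \<open>The single terms \<open>A1\<close> and \<open>A2\<close> are of first order in w and
  could be integrated against m only for small \<alpha>; hence the identity is proved for one w at a
  time.\<close>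

lemma form_density_section:
  "(LINT x|lborel. form_density x w) = complex_of_real (LINT x|lborel. energy_density x w)"
proof (cases "0 < w")
  case w: True
  define A1 A2 where "A1 x = indicator {0<..} x *\<^sub>R ((v x - v (x + w)) * cnj (v x))"
    and "A2 x = indicator {w<..} x *\<^sub>R ((v x - v (x - w)) * cnj (v x))" for x
  have times_v: "integrable lborel (\<lambda>x. g x * cnj (v x))"
    if [measurable]: "g \<in> borel_measurable borel" and "\<And>x. norm (g x) \<le> 2 * K" for g
  proof (rule Bochner_Integration.integrable_bound)
    show "integrable lborel (\<lambda>x. 2 * K * norm (v x))" using v_integrable by simp
    show "AE x in lborel. norm (g x * cnj (v x)) \<le> norm (2 * K * norm (v x))"
      using that(2) K by (auto simp: norm_mult abs_mult intro!: mult_right_mono)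
  qed measurable
  have diff: "norm (v x - v y) \<le> 2 * K" for x y
    using norm_triangle_ineq4[of "v x" "v y"] v_le_K[of x] v_le_K[of y] by linarith
  have A_int: "integrable lborel A1" "integrable lborel A2"
    unfolding A1_def[abs_def] A2_def[abs_def]
    by (intro integrable_mult_indicator times_v diff; measurable)+
  have "(LINT x|lborel. form_density x w) = (LINT x|lborel. complex_of_real (m w) * (A1 x + A2 x))"
    using w by (intro Bochner_Integration.integral_cong)
      (auto simp: form_density_def sym_diff_Rplus_def A1_def A2_def indicator_def algebra_simps)
  also have "\<dots> = complex_of_real (m w) * ((LINT x|lborel. A1 x) + (LINT x|lborel. A2 (x + w)))"
    using A_int by (simp add: lborel_integral_shift(1)[of A2])
  also have "\<dots> = (LINT x|lborel. complex_of_real (m w) * (A1 x + A2 (x + w)))"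
    using A_int by (simp add: lborel_integral_shift(2)[of A2])
  also have "\<dots> = (LINT x|lborel. complex_of_real (energy_density x w))"
  proof (intro Bochner_Integration.integral_cong refl)
    fix x
    \<comment> \<open>Shifting turns the restriction x > w of the backward difference into x > 0 and
      its factor into -(v(x) - v(x + w)) cnj(v(x + w)), which completes the square.\<close>
    have "A1 x + A2 (x + w) = indicator {0<..} x *\<^sub>R ((v x - v (x + w)) * cnj (v x - v (x + w)))"
      using w by (auto simp: A1_def A2_def indicator_def algebra_simps)
    also have "\<dots> = indicator {0<..} x *\<^sub>R complex_of_real ((cmod (v x - v (x + w)))\<^sup>2)"
      by (simp only: complex_norm_square)
    finally show "complex_of_real (m w) * (A1 x + A2 (x + w)) = complex_of_real (energy_density x w)"
      using w by (simp add: energy_density_def indicator_def)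
  qed
  finally show ?thesis by simp
qed (simp add: form_density_def energy_density_def)

text \<open>Fubini is used twice: for \<open>form_density\<close> to reach fixed w, and for the
  nonnegative \<open>energy_density\<close> to return. Integrability is recorded separately because
  a divergent Bochner integral would equal 0.\<close>

lemma Acal_density_form:
  shows "set_integrable lborel {0<..} (\<lambda>x. Acal_density x * cnj (v x))"
    and "(LINT x:{0<..}|lborel. Acal_density x * cnj (v x)) =
      complex_of_real ((LINT x:{0<..}|lborel. (cmod (v x))\<^sup>2) + (LINT x|lborel. LINT w|lborel. energy_density x w))"
proof -
  have sq: "integrable lborel (\<lambda>x. indicator {0<..} x *\<^sub>R (v x * cnj (v x)))"
  proof (intro integrable_mult_indicator)
    show "integrable lborel (\<lambda>x. v x * cnj (v x))"
    proof (rule Bochner_Integration.integrable_bound)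
      show "integrable lborel (\<lambda>x. K * norm (v x))" using v_integrable by simp
      show "AE x in lborel. norm (v x * cnj (v x)) \<le> norm (K * norm (v x))"
        using v_le_K K by (auto simp: norm_mult abs_mult intro!: mult_right_mono)
    qed measurable
  qed simp
  have w: "indicator {0<..} x *\<^sub>R (Acal_density x * cnj (v x)) =
      indicator {0<..} x *\<^sub>R (v x * cnj (v x)) + (LINT w|lborel. form_density x w)" for x
    unfolding form_density_def integral_mult_right_zero
    by (simp add: Acal_density_def set_lebesgue_integral_def algebra_simps)
  note form = lborel_pair.integrable_fst'[OF form_density_integrable, simplified]
  show "set_integrable lborel {0<..} (\<lambda>x. Acal_density x * cnj (v x))"
    unfolding set_integrable_def w by (intro Bochner_Integration.integrable_add sq form)
  have "(LINT x:{0<..}|lborel. Acal_density x * cnj (v x)) =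
      (LINT x|lborel. indicator {0<..} x *\<^sub>R (v x * cnj (v x))) + (LINT x|lborel. LINT w|lborel. form_density x w)"
    unfolding set_lebesgue_integral_def w by (rule Bochner_Integration.integral_add[OF sq form])
  also have "(LINT x|lborel. LINT w|lborel. form_density x w) = (LINT w|lborel. LINT x|lborel. form_density x w)"
    by (rule lborel_pair.Fubini_integral[OF form_density_integrable, symmetric])
  also have "\<dots> = complex_of_real (LINT w|lborel. LINT x|lborel. energy_density x w)"
    by (simp add: form_density_section)
  also have "(LINT w|lborel. LINT x|lborel. energy_density x w) = (LINT x|lborel. LINT w|lborel. energy_density x w)"
    by (rule lborel_pair.Fubini_integral[OF energy_density_integrable])
  also have "(LINT x|lborel. indicator {0<..} x *\<^sub>R (v x * cnj (v x))) =
      complex_of_real (LINT x:{0<..}|lborel. (cmod (v x))\<^sup>2)"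
  proof -
    have "indicator {0<..} x *\<^sub>R (v x * cnj (v x)) = complex_of_real (indicator {0<..} x *\<^sub>R (cmod (v x))\<^sup>2)" for x
      by (simp add: complex_norm_square[symmetric] indicator_def)
    then show ?thesis
      by (simp only: integral_complex_of_real set_lebesgue_integral_def)
  qed
  finally show "(LINT x:{0<..}|lborel. Acal_density x * cnj (v x)) =
      complex_of_real ((LINT x:{0<..}|lborel. (cmod (v x))\<^sup>2) + (LINT x|lborel. LINT w|lborel. energy_density x w))"
    by simp
qed

text \<open>Off the diagonal at most one of the two energy terms is nonzero, and on it everything
  vanishes. The shear y = x + w and the swap of x and y show that both contribute equally; this
  factor 2 cancels the 1/2 in the quadratic form.\<close>

lemma double_integral_energy:
  shows "integrable (lborel \<Otimes>\<^sub>M lborel)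
      (\<lambda>(x, y). indicator ({0<..} \<times> {0<..}) (x, y) * (cmod (v x - v y))\<^sup>2 * m \<bar>x - y\<bar>)"
    and "(LINT x:{0<..}|lborel. LINT y:{0<..}|lborel. (cmod (v x - v y))\<^sup>2 * m \<bar>x - y\<bar>) =
      2 * (LINT x|lborel. LINT w|lborel. energy_density x w)"
proof -
  define F where "F x y = indicator ({0<..} \<times> {0<..}) (x, y) * (cmod (v x - v y))\<^sup>2 * m \<bar>x - y\<bar>" for x y :: real
  have F: "F x y = energy_density x (y - x) + energy_density y (x - y)" for x y
    by (auto simp: F_def energy_density_def indicator_def norm_minus_commute abs_if)
  let ?E = "\<lambda>(x, y). energy_density x (y - x)"
  have E_meas: "?E \<in> borel_measurable (lborel \<Otimes>\<^sub>M lborel)"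
    by measurable
  have shift: "(LINT y|lborel. energy_density x (y - x)) = (LINT w|lborel. energy_density x w)"
    "integrable lborel (\<lambda>y. energy_density x (y - x)) \<longleftrightarrow> integrable lborel (energy_density x)" for x
    using lborel_integral_shift[of "energy_density x" "- x"] by simp_all
  have E_int: "integrable (lborel \<Otimes>\<^sub>M lborel) ?E"
  proof (rule lborel_pair.Fubini_integrable[OF E_meas])
    show "integrable lborel (\<lambda>x. LINT y|lborel. norm (?E (x, y)))"
      using lborel_pair.integrable_fst'[OF energy_density_integrable]
      by (simp add: energy_density_nonneg shift)
    \<comment> \<open>Integrability on the product yields integrable sections only for almost every
      x.\<close>
    show "AE x in lborel. integrable lborel (\<lambda>y. ?E (x, y))"
      using lborel_pair.AE_integrable_fst'[OF energy_density_integrable] by (simp add: shift)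
  qed
  have E'_int: "integrable (lborel \<Otimes>\<^sub>M lborel) (\<lambda>(x, y). energy_density y (x - y))"
    using lborel_pair.integrable_product_swap[OF E_int] by simp
  have E': "integral\<^sup>L (lborel \<Otimes>\<^sub>M lborel) (\<lambda>(x, y). energy_density y (x - y)) = integral\<^sup>L (lborel \<Otimes>\<^sub>M lborel) ?E"
    using lborel_pair.integral_product_swap[OF E_meas] by simp
  have E: "integral\<^sup>L (lborel \<Otimes>\<^sub>M lborel) ?E = (LINT x|lborel. LINT w|lborel. energy_density x w)"
    using lborel_pair.integral_fst'[OF E_int] by (simp add: shift)
  have F': "(\<lambda>(x, y). F x y) = (\<lambda>z. ?E z + (case z of (x, y) \<Rightarrow> energy_density y (x - y)))"
    by (auto simp: F)
  have F_int: "integrable (lborel \<Otimes>\<^sub>M lborel) (\<lambda>(x, y). F x y)"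
    unfolding F' by (intro Bochner_Integration.integrable_add E_int E'_int)
  then show "integrable (lborel \<Otimes>\<^sub>M lborel)
      (\<lambda>(x, y). indicator ({0<..} \<times> {0<..}) (x, y) * (cmod (v x - v y))\<^sup>2 * m \<bar>x - y\<bar>)"
    by (simp add: F_def)
  have F_eq: "F x y = indicator {0<..} x *\<^sub>R (indicator {0<..} y *\<^sub>R ((cmod (v x - v y))\<^sup>2 * m \<bar>x - y\<bar>))" for x y
    by (simp add: F_def indicator_times)
  have "(LINT x:{0<..}|lborel. LINT y:{0<..}|lborel. (cmod (v x - v y))\<^sup>2 * m \<bar>x - y\<bar>) =
      (LINT x|lborel. LINT y|lborel. F x y)"
    unfolding set_lebesgue_integral_def F_eq by simp
  also have "\<dots> = integral\<^sup>L (lborel \<Otimes>\<^sub>M lborel) (\<lambda>(x, y). F x y)"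
    using lborel_pair.integral_fst'[OF F_int] by simp
  also have "\<dots> = 2 * (LINT x|lborel. LINT w|lborel. energy_density x w)"
    unfolding F' using Bochner_Integration.integral_add[OF E_int E'_int] E E' by simp
  finally show "(LINT x:{0<..}|lborel. LINT y:{0<..}|lborel. (cmod (v x - v y))\<^sup>2 * m \<bar>x - y\<bar>) =
      2 * (LINT x|lborel. LINT w|lborel. energy_density x w)" .
qed

end

lemma levy_kernel_bigo:
  assumes "0 < \<alpha>" "\<alpha> < 1"
  shows "levy_kernel \<alpha> \<in> O[at_right 0](\<lambda>w. w powr (- 1 - 2 * \<alpha>))"
    and "levy_kernel \<alpha> \<in> O[at_top](\<lambda>w. exp (- w))"
proof -
  obtain C where C: "\<And>w. 0 < w \<Longrightarrow> levy_kernel \<alpha> w \<le> C * w powr (- 1 - 2 * \<alpha>)"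
    using levy_kernel_le_powr[OF assms] by blast
  show "levy_kernel \<alpha> \<in> O[at_right 0](\<lambda>w. w powr (- 1 - 2 * \<alpha>))"
  proof (rule bigoI)
    show "\<forall>\<^sub>F w in at_right 0. norm (levy_kernel \<alpha> w) \<le> C * norm (w powr (- 1 - 2 * \<alpha>))"
      using eventually_at_right_less[of "0::real"]
      by eventually_elim (use C levy_kernel_nonneg[OF assms] in simp)
  qed
  obtain C' where C': "\<And>w. 4 \<le> w \<Longrightarrow> levy_kernel \<alpha> w \<le> C' * exp (- w)"
    using levy_kernel_le_exp[OF assms] by blast
  show "levy_kernel \<alpha> \<in> O[at_top](\<lambda>w. exp (- w))"
  proof (rule bigoI)
    show "\<forall>\<^sub>F w in at_top. norm (levy_kernel \<alpha> w) \<le> C' * norm (exp (- w))"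
      using eventually_ge_at_top[of "4::real"]
      by eventually_elim (use C' levy_kernel_nonneg[OF assms] in simp)
  qed
qed

theorem theorem2p1:
  fixes \<alpha> :: real and v :: "real \<Rightarrow> complex"
  assumes "0 < \<alpha>" "\<alpha> < 1" "schwartz v"
  shows "\<exists>m :: real \<Rightarrow> real.
    m \<in> borel_measurable borel \<and>
    m \<in> O[at_right 0](\<lambda>w. w powr (- 1 - 2 * \<alpha>)) \<and>
    m \<in> O[at_top](\<lambda>w. exp (- w)) \<and>
    (\<forall>x > 0. ((\<lambda>\<epsilon>. LINT y:{0<..}|lborel.
        (v x - v y) * complex_of_real (indicator {\<epsilon><..} \<bar>x - y\<bar> * m \<bar>x - y\<bar>))
       \<longlongrightarrow> Acal \<alpha> v x - v x) (at_right 0)) \<and>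
    set_integrable lborel {0<..} (\<lambda>x. Acal \<alpha> v x * cnj (v x)) \<and>
    integrable (lborel \<Otimes>\<^sub>M lborel)
      (\<lambda>(x, y). indicator ({0<..} \<times> {0<..}) (x, y) * (cmod (v x - v y))\<^sup>2 * m \<bar>x - y\<bar>) \<and>
    (LINT x:{0<..}|lborel. Acal \<alpha> v x * cnj (v x)) =
      complex_of_real ((LINT x:{0<..}|lborel. (cmod (v x))\<^sup>2) +
        1 / 2 * (LINT x:{0<..}|lborel. LINT y:{0<..}|lborel. (cmod (v x - v y))\<^sup>2 * m \<bar>x - y\<bar>))"
proof -
  obtain K where K: "0 \<le> K" "\<And>x. norm (v x) \<le> K / (1 + x\<^sup>2)"
    "\<And>x. norm (vderiv_iter 1 v x) \<le> K / (1 + x\<^sup>2)" "\<And>x. norm (vderiv_iter 2 v x) \<le> K"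
    using schwartz_bounds[OF assms(3)] by blast
  interpret schwartz_half_line \<alpha> v K
    by unfold_locales (use assms K in \<open>auto simp: schwartz_def\<close>)
  \<comment> \<open>\<open>Acal\<close> is known only for x > 0, so it is replaced under the
    indicator.\<close>
  have form_cong: "indicator {0<..} x *\<^sub>R (Acal \<alpha> v x * cnj (v x)) =
      indicator {0<..} x *\<^sub>R (Acal_density x * cnj (v x))" for x
    by (cases "0 < x") (simp_all add: Acal_eq)
  have "((\<lambda>\<epsilon>. LINT y:{0<..}|lborel.
        (v x - v y) * complex_of_real (indicator {\<epsilon><..} \<bar>x - y\<bar> * m \<bar>x - y\<bar>))
       \<longlongrightarrow> Acal \<alpha> v x - v x) (at_right 0)" if "0 < x" for x
    unfolding Acal_eq[OF that] by (rule Acal_density_principal_value[OF that])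
  moreover have "set_integrable lborel {0<..} (\<lambda>x. Acal \<alpha> v x * cnj (v x))"
    using Acal_density_form(1) unfolding set_integrable_def form_cong .
  moreover have "(LINT x:{0<..}|lborel. Acal \<alpha> v x * cnj (v x)) =
      complex_of_real ((LINT x:{0<..}|lborel. (cmod (v x))\<^sup>2) +
        1 / 2 * (LINT x:{0<..}|lborel. LINT y:{0<..}|lborel. (cmod (v x - v y))\<^sup>2 * m \<bar>x - y\<bar>))"
  proof -
    have "(LINT x:{0<..}|lborel. Acal \<alpha> v x * cnj (v x)) = (LINT x:{0<..}|lborel. Acal_density x * cnj (v x))"
      unfolding set_lebesgue_integral_def form_cong ..
    also note Acal_density_form(2)
    finally show ?thesis
      by (simp only: double_integral_energy(2)) simp
  qed
  ultimately show ?thesis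
    using levy_kernel_measurable[of \<alpha>] levy_kernel_bigo[OF assms(1,2)] double_integral_energy(1)
    by (intro exI[of _ m] conjI allI impI)
qed

end
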